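(* Let $N\ge2$. The restriction of the string Fourier transform $\mathfrak{F}_{\mathrm{s}}$ to the zero-graded part of the $2$-box space $PF_2$ of the parafermion planar para algebra is the discrete Fourier transform on the group $\mathbb{Z}_N$: with $g_i=\zeta^{i^2}c_1^{\,i}c_2^{-i}$ for $i\in\mathbb{Z}_N$ (a basis of the zero-graded part of $PF_2$), $$\mathfrak{F}_{\mathrm{s}}(g_i)=\frac1{\sqrt N}\sum_{j=0}^{N-1}q^{ij}\,g_j .$$
   Context: Let $q=e^{2\pi i/N}$ and let $\zeta$ be a square root of $q$ with $\zeta^{N^2}=1$. $PF_m$ is the complex algebra generated by $c_1,\dots,c_m$ with $c_i^N=1$ and $c_ic_j=q\,c_jc_i$ for $i<j$; it has basis $c_1^{i_1}\cdots c_m^{i_m}$, $0\le i_1,\dots,i_m\le N-1$, is $\mathbb{Z}_N$-graded with each $c_i$ of grading $1$, and has the trace $\mathrm{tr}(1)=1$, $\mathrm{tr}(c_1^{i_1}\cdots c_m^{i_m})=0$ for basis elements other than $1$. $PF_m\subset PF_{m+1}$ naturally. $PF_m$ is the $m$-box space of the parafermion planar para algebra, and $g_i$ is the twisted tensor product of $c^i$ and $c^{-i}$ (two vertical strings with labels $c^i$ and $c^{-i}$ drawn at the same level). Let $E_i=\frac1{\sqrt N}\sum_{k=0}^{N-1}\zeta^{k^2}c_i^{\,k}c_{i+1}^{-k}$, let $\iota_l:PF_m\to PF_{m+1}$ be the homomorphism $c_i\mapsto c_{i+1}$, and let $\Phi_r:PF_{m+1}\to PF_m$ be the trace-preserving conditional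 expectation onto the subalgebra generated by $c_1,\dots,c_m$. The string Fourier transform on $PF_m$ (diagrammatically the clockwise one-string rotation) is $$\mathfrak{F}_{\mathrm{s}}(x)=\sqrt N\,\Phi_r\bigl(E_mE_{m-1}\cdots E_1\,\iota_l(x)\bigr).$$ *)

theory Defs
  imports
    Complex_Main
    "HOL-Library.Poly_Mapping"
    "HOL-Library.FuncSet"
    "HOL-Number_Theory.Cong"
    "HOL-Algebra.QuotRing"
    "HOL-Algebra.Embedded_Algebras"
begin

text \<open>Words form the free monoid, written additively, so that the convolution product of
  \<^theory>\<open>HOL-Library.Poly_Mapping\<close> on finitely supported functions from words to the complex
  numbers is the product of noncommutative polynomials.\<close>

datatype gen_word = Word (letters: "nat list")

instantiation gen_word :: monoid_add
begin

definition zero_gen_word :: gen_word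
  where "0 = Word []"

definition plus_gen_word :: "gen_word \<Rightarrow> gen_word \<Rightarrow> gen_word"
  where "u + v = Word (letters u @ letters v)"

instance
  by standard (simp_all add: zero_gen_word_def plus_gen_word_def)

end

type_synonym free_elem = "gen_word \<Rightarrow>\<^sub>0 complex"

definition free_gen :: "nat \<Rightarrow> free_elem"
  where "free_gen i = Poly_Mapping.single (Word [i]) 1"

definition free_const :: "complex \<Rightarrow> free_elem"
  where "free_const a = Poly_Mapping.single 0 a"

definition free_alg :: "nat \<Rightarrow> free_elem ring"
  where "free_alg m =
    \<lparr>carrier = {p. \<forall>w\<in>Poly_Mapping.keys p. set (letters w) \<subseteq> {1..m}}, mult = (*), one = 1,
     zero = 0, add = (+)\<rparr>"

definition pf_q :: "nat \<Rightarrow> complex"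
  where "pf_q N = exp (2 * of_real pi * \<i> / of_nat N)"

definition pf_relators :: "nat \<Rightarrow> nat \<Rightarrow> free_elem set"
  where "pf_relators N m =
    {free_gen i ^ N - 1 | i. i \<in> {1..m}} \<union>
    {free_gen i * free_gen j - free_const (pf_q N) * (free_gen j * free_gen i) | i j.
       i \<in> {1..m} \<and> j \<in> {1..m} \<and> i < j}"

definition pf_ideal :: "nat \<Rightarrow> nat \<Rightarrow> free_elem set"
  where "pf_ideal N m = genideal (free_alg m) (pf_relators N m)"

text \<open>In HOL-Algebra \<^const>\<open>ideal\<close> means two-sided ideal, so this is the unital complex algebra
  presented by the generators \<open>c\<^sub>1, \<dots>, c\<^sub>m\<close> and the relations above. Its elements are cosets.\<close>

definition PF :: "nat \<Rightarrow> nat \<Rightarrow> free_elem set ring"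
  where "PF N m = free_alg m Quot pf_ideal N m"

lemma free_alg_closed_mult:
  "p \<in> carrier (free_alg m) \<Longrightarrow> r \<in> carrier (free_alg m) \<Longrightarrow>
    p * r \<in> carrier (free_alg m)"
  unfolding free_alg_def partial_object.simps mem_Collect_eq
proof
  fix w
  assume p: "\<forall>u\<in>Poly_Mapping.keys p. set (letters u) \<subseteq> {1..m}"
    and r: "\<forall>v\<in>Poly_Mapping.keys r. set (letters v) \<subseteq> {1..m}"
    and "w \<in> Poly_Mapping.keys (p * r)"
  then obtain u v where "w = u + v" "u \<in> Poly_Mapping.keys p" "v \<in> Poly_Mapping.keys r"
    using keys_mult[of p r] by blast
  with p r show "set (letters w) \<subseteq> {1..m}"
    by (simp add: plus_gen_word_def)
qed

lemma free_alg_closed_add: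
  "p \<in> carrier (free_alg m) \<Longrightarrow> r \<in> carrier (free_alg m) \<Longrightarrow>
    p + r \<in> carrier (free_alg m)"
  using Poly_Mapping.keys_add[of p r]
  unfolding free_alg_def partial_object.simps mem_Collect_eq by blast

lemma free_alg_sel:
  "mult (free_alg m) = (*)" "one (free_alg m) = 1" "zero (free_alg m) = 0"
  "add (free_alg m) = (+)"
  by (simp_all only: free_alg_def monoid.simps ring.simps)

lemma free_alg_closed_one: "1 \<in> carrier (free_alg m)"
  by (simp add: free_alg_def zero_gen_word_def)

lemma free_alg_closed_zero: "0 \<in> carrier (free_alg m)"
  by (simp add: free_alg_def)

lemma free_alg_closed_uminus: "p \<in> carrier (free_alg m) \<Longrightarrow> - p \<in> carrier (free_alg m)"
  by (simp add: free_alg_def)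

lemma ring_free_alg: "ring (free_alg m)"
proof (rule ringI)
  show "abelian_group (free_alg m)"
  proof (rule abelian_groupI, unfold free_alg_sel)
    fix x assume "x \<in> carrier (free_alg m)"
    then show "\<exists>y\<in>carrier (free_alg m). y + x = 0"
      by (intro bexI[of _ "- x"] free_alg_closed_uminus) simp_all
  qed (simp_all only: free_alg_closed_add free_alg_closed_zero ac_simps add_0_left add_0_right)
  show "monoid (free_alg m)"
    by (rule monoidI, unfold free_alg_sel)
      (simp_all only: free_alg_closed_mult free_alg_closed_one mult.assoc mult_1_left mult_1_right)
qed (simp_all only: free_alg_sel distrib_left distrib_right)

lemma pf_relators_closed: "pf_relators N m \<subseteq> carrier (free_alg m)"
proof -
  have g: "i \<in> {1..m} \<Longrightarrow> free_gen i \<in> carrier (free_alg m)" for i by (auto simp: free_alg_def free_gen_def)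
  have c: "free_const a \<in> carrier (free_alg m)" for a by (auto simp: free_alg_def free_const_def zero_gen_word_def)
  have p: "i \<in> {1..m} \<Longrightarrow> free_gen i ^ n \<in> carrier (free_alg m)" for i n
    by (induct n) (simp_all add: g free_alg_closed_one free_alg_closed_mult)
  have d: "x \<in> carrier (free_alg m) \<Longrightarrow> y \<in> carrier (free_alg m) \<Longrightarrow> x - y \<in> carrier (free_alg m)" for x y
    using free_alg_closed_add[OF _ free_alg_closed_uminus, of x m y] by simp
  show ?thesis
  proof
    fix x
    assume "x \<in> pf_relators N m"
    then consider i where "i \<in> {1..m}" "x = free_gen i ^ N - 1"
      | i j where "i \<in> {1..m}" "j \<in> {1..m}"
          "x = free_gen i * free_gen j - free_const (pf_q N) * (free_gen j * free_gen i)"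
      unfolding pf_relators_def by blast
    then show "x \<in> carrier (free_alg m)"
      by cases (simp_all only: g free_alg_closed_one c p d free_alg_closed_mult)
  qed
qed

lemma ring_PF: "ring (PF N m)"
  unfolding PF_def pf_ideal_def
  by (rule ideal.quotient_is_ring[OF ring.genideal_ideal[OF ring_free_alg pf_relators_closed]])

definition pf_class :: "nat \<Rightarrow> nat \<Rightarrow> free_elem \<Rightarrow> free_elem set"
  where "pf_class N m p = pf_ideal N m +>\<^bsub>free_alg m\<^esub> p"

definition pf_gen :: "nat \<Rightarrow> nat \<Rightarrow> nat \<Rightarrow> free_elem set"
  where "pf_gen N m i = pf_class N m (free_gen i)"

text \<open>The complex vector space structure of \<open>PF N m\<close> is given by multiplication with the
  central elements \<open>pf_const N m a\<close>, the multiples of the unit.\<close>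

definition pf_const :: "nat \<Rightarrow> nat \<Rightarrow> complex \<Rightarrow> free_elem set"
  where "pf_const N m a = pf_class N m (free_const a)"

definition pf_smult :: "nat \<Rightarrow> nat \<Rightarrow> complex \<Rightarrow> free_elem set \<Rightarrow> free_elem set"
  where "pf_smult N m a x = pf_const N m a \<otimes>\<^bsub>PF N m\<^esub> x"

definition pf_exponents :: "nat \<Rightarrow> nat \<Rightarrow> (nat \<Rightarrow> nat) set"
  where "pf_exponents N m = {1..m} \<rightarrow>\<^sub>E {..<N}"

text \<open>The basis monomial \<open>c\<^sub>1\<^bsup>e 1\<^esup> \<cdots> c\<^sub>m\<^bsup>e m\<^esup>\<close>.\<close>

definition pf_monom :: "nat \<Rightarrow> nat \<Rightarrow> (nat \<Rightarrow> nat) \<Rightarrow> free_elem set"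
  where "pf_monom N m e =
    foldr (\<lambda>i y. (pf_gen N m i [^]\<^bsub>PF N m\<^esub> e i) \<otimes>\<^bsub>PF N m\<^esub> y) [1..<Suc m] \<one>\<^bsub>PF N m\<^esub>"

text \<open>The component of degree \<open>d\<close> modulo \<open>N\<close>, all generators having degree 1.\<close>

definition pf_graded :: "nat \<Rightarrow> nat \<Rightarrow> nat \<Rightarrow> free_elem set set"
  where "pf_graded N m d =
    {\<Oplus>\<^bsub>PF N m\<^esub>e\<in>pf_exponents N m. pf_smult N m (a e) (pf_monom N m e) | a.
       \<forall>e\<in>pf_exponents N m. a e \<noteq> 0 \<longrightarrow> [(\<Sum>i = 1..m. e i) = d] (mod N)}"

text \<open>A list is a basis of a complex subspace: \<^const>\<open>ring.independent\<close> and \<^const>\<open>ring.Span\<close> are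
  taken over the copy of the complex field formed by the multiples of the unit.\<close>

definition pf_basis :: "nat \<Rightarrow> nat \<Rightarrow> free_elem set list \<Rightarrow> free_elem set set \<Rightarrow> bool"
  where "pf_basis N m xs V \<longleftrightarrow>
    ring.independent (PF N m) (range (pf_const N m)) xs \<and>
    ring.Span (PF N m) (range (pf_const N m)) xs = V"

text \<open>The trace, the homomorphisms and the conditional expectation defined below are characterised
  uniquely on the carrier; being extensional, they are unique as total functions, and \<open>THE\<close>
  selects them.\<close>

definition pf_tr :: "nat \<Rightarrow> nat \<Rightarrow> free_elem set \<Rightarrow> complex"
  where "pf_tr N m = (THE t.
    t \<in> extensional (carrier (PF N m)) \<and>
    (\<forall>x\<in>carrier (PF N m). \<forall>y\<in>carrier (PF N m). t (x \<oplus>\<^bsub>PF N m\<^esub> y) = t x + t y) \<and>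
    (\<forall>a. \<forall>x\<in>carrier (PF N m). t (pf_smult N m a x) = a * t x) \<and>
    (\<forall>e\<in>pf_exponents N m. t (pf_monom N m e) = (if \<forall>i\<in>{1..m}. e i = 0 then 1 else 0)))"

definition pf_alg_hom :: "nat \<Rightarrow> nat \<Rightarrow> nat \<Rightarrow> (free_elem set \<Rightarrow> free_elem set) \<Rightarrow> bool"
  where "pf_alg_hom N m n h \<longleftrightarrow>
    h \<in> ring_hom (PF N m) (PF N n) \<and>
    (\<forall>a. \<forall>x\<in>carrier (PF N m). h (pf_smult N m a x) = pf_smult N n a (h x))"

definition pf_incl :: "nat \<Rightarrow> nat \<Rightarrow> free_elem set \<Rightarrow> free_elem set"
  where "pf_incl N m = (THE h.
    h \<in> extensional (carrier (PF N m)) \<and> pf_alg_hom N m (m + 1) h \<and>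
    (\<forall>i\<in>{1..m}. h (pf_gen N m i) = pf_gen N (m + 1) i))"

definition pf_iota_l :: "nat \<Rightarrow> nat \<Rightarrow> free_elem set \<Rightarrow> free_elem set"
  where "pf_iota_l N m = (THE h.
    h \<in> extensional (carrier (PF N m)) \<and> pf_alg_hom N m (m + 1) h \<and>
    (\<forall>i\<in>{1..m}. h (pf_gen N m i) = pf_gen N (m + 1) (i + 1)))"

definition pf_cond_exp :: "nat \<Rightarrow> nat \<Rightarrow> (free_elem set \<Rightarrow> free_elem set) \<Rightarrow> bool"
  where "pf_cond_exp N m \<Phi> \<longleftrightarrow>
    \<Phi> \<in> carrier (PF N (m + 1)) \<rightarrow> carrier (PF N m) \<and>
    (\<forall>x\<in>carrier (PF N (m + 1)). \<forall>y\<in>carrier (PF N (m + 1)).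
       \<Phi> (x \<oplus>\<^bsub>PF N (m + 1)\<^esub> y) = \<Phi> x \<oplus>\<^bsub>PF N m\<^esub> \<Phi> y) \<and>
    (\<forall>a. \<forall>x\<in>carrier (PF N (m + 1)). \<Phi> (pf_smult N (m + 1) a x) = pf_smult N m a (\<Phi> x)) \<and>
    (\<forall>a\<in>carrier (PF N m). \<Phi> (pf_incl N m a) = a) \<and>
    (\<forall>a\<in>carrier (PF N m). \<forall>b\<in>carrier (PF N m). \<forall>x\<in>carrier (PF N (m + 1)).
       \<Phi> (pf_incl N m a \<otimes>\<^bsub>PF N (m + 1)\<^esub> x \<otimes>\<^bsub>PF N (m + 1)\<^esub> pf_incl N m b)
         = a \<otimes>\<^bsub>PF N m\<^esub> \<Phi> x \<otimes>\<^bsub>PF N m\<^esub> b) \<and>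
    (\<forall>x\<in>carrier (PF N (m + 1)). pf_tr N m (\<Phi> x) = pf_tr N (m + 1) x)"

definition pf_Phi_r :: "nat \<Rightarrow> nat \<Rightarrow> free_elem set \<Rightarrow> free_elem set"
  where "pf_Phi_r N m =
    (THE \<Phi>. \<Phi> \<in> extensional (carrier (PF N (m + 1))) \<and> pf_cond_exp N m \<Phi>)"

text \<open>\<open>pf_E N \<zeta> n i\<close> is \<open>E\<^sub>i\<close> as an element of \<open>PF N n\<close>. Negative powers of generators are powers
  with integer exponents in HOL-Algebra, which use the inverse in the multiplicative monoid.\<close>

definition pf_E :: "nat \<Rightarrow> complex \<Rightarrow> nat \<Rightarrow> nat \<Rightarrow> free_elem set"
  where "pf_E N \<zeta> n i = pf_smult N n (1 / of_real (sqrt (real N)))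
    (\<Oplus>\<^bsub>PF N n\<^esub>k\<in>{..<N}. pf_smult N n (\<zeta> ^ (k\<^sup>2))
       ((pf_gen N n i [^]\<^bsub>PF N n\<^esub> k) \<otimes>\<^bsub>PF N n\<^esub> (pf_gen N n (i + 1) [^]\<^bsub>PF N n\<^esub> (- int k))))"

text \<open>The fold is \<open>E\<^sub>m (E\<^sub>m\<^sub>-\<^sub>1 (\<cdots> (E\<^sub>1 \<iota>\<^sub>l(x))))\<close>.\<close>

definition pf_SFT :: "nat \<Rightarrow> complex \<Rightarrow> nat \<Rightarrow> free_elem set \<Rightarrow> free_elem set"
  where "pf_SFT N \<zeta> m x = pf_smult N m (of_real (sqrt (real N)))
    (pf_Phi_r N m
      (foldr (\<lambda>i y. pf_E N \<zeta> (m + 1) i \<otimes>\<^bsub>PF N (m + 1)\<^esub> y) (rev [1..<Suc m]) (pf_iota_l N m x)))"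

definition pf_g :: "nat \<Rightarrow> complex \<Rightarrow> int \<Rightarrow> free_elem set"
  where "pf_g N \<zeta> i = pf_smult N 2 (\<zeta> powi (i\<^sup>2))
    ((pf_gen N 2 1 [^]\<^bsub>PF N 2\<^esub> i) \<otimes>\<^bsub>PF N 2\<^esub> (pf_gen N 2 2 [^]\<^bsub>PF N 2\<^esub> (- i)))"

text \<open>The unitary discrete Fourier transform on the integers modulo \<open>N\<close>, on functions given by
  their values at the representatives \<open>0, \<dots>, N - 1\<close>.\<close>

definition dft :: "nat \<Rightarrow> (nat \<Rightarrow> complex) \<Rightarrow> nat \<Rightarrow> complex"
  where "dft N a j = 1 / of_real (sqrt (real N)) * (\<Sum>i<N. pf_q N ^ (i * j) * a i)"

end

theory Submission
  imports Defs "HOL-Library.Multiset"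
begin

text \<open>The transform is evaluated directly. The product \<open>E\<^sub>2 E\<^sub>1 \<iota>\<^sub>l(g\<^sub>i)\<close> is a double sum of multiples
  of monomials in \<open>c\<^sub>1\<close>, \<open>c\<^sub>2\<close>, \<open>c\<^sub>3\<close>, with \<open>l\<close> and \<open>k\<close> the summation indices of \<open>E\<^sub>2\<close> and \<open>E\<^sub>1\<close>; the
  exponent of \<open>c\<^sub>3\<close> is \<open>- l - i\<close>. The conditional expectation keeps exactly the monomials without
  \<open>c\<^sub>3\<close>, so it forces \<open>l = - i\<close> and leaves a sum over \<open>k\<close> of multiples of \<open>c\<^sub>1\<^sup>k c\<^sub>2\<^sup>-\<^sup>k\<close>. Sorting the letters
  gives a power of \<open>q\<close>, which combines with the factors \<open>\<zeta>\<^bsup>l\<^sup>2\<^esup> \<zeta>\<^bsup>i\<^sup>2\<^esup> = q\<^bsup>i\<^sup>2\<^esup>\<close> to \<open>q\<^bsup>i k\<^esup>\<close>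
  (\<open>SFT_rep_g\<close>). The statement on arbitrary combinations of the \<open>g\<^sub>i\<close> follows by linearity.

  The work lies in the algebra, which is given as a quotient of a free algebra, with structure maps
  characterised by their properties. The key is an explicit description of the quotient. For a word
  \<open>u\<close> let \<open>coef u\<close> collect the coefficients of all words whose letter counts agree with those of \<open>u\<close>
  modulo \<open>N\<close>, each weighted by the power of \<open>q\<close> that rewrites it as a multiple of \<open>u\<close>. The elements
  on which all these functionals vanish form an ideal containing the relators, and conversely the
  relations reduce every word to a sorted one; hence two elements have the same class iff all
  their coefficients agree (\<open>pf_class_eq_iff\<close>). In particular the sorted monomials form a basis.

  The structure maps can then be exhibited on representatives. The trace is the coefficient at the
  empty word (\<open>pf_tr_eq\<close>), \<open>\<iota>\<^sub>l\<close> increases all letters by one (\<open>pf_iota_l_class\<close>), and the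
  conditional expectation discards the basis monomials that involve the last generator
  (\<open>pf_Phi_r_class\<close>). The conditional expectation is unique since the trace is nondegenerate
  (\<open>trace_nondegenerate\<close>).

  That the \<open>g\<^sub>i\<close> form a basis of the zero-graded part is read off from the coefficients: a basis
  monomial \<open>c\<^sub>1\<^sup>a c\<^sub>2\<^sup>b\<close> has degree zero iff \<open>b = - a\<close> modulo \<open>N\<close>, and then it is a nonzero multiple of
  \<open>g\<^sub>a\<close>.\<close>

section \<open>Words, inversions and phases\<close>

text \<open>The relation \<open>c\<^sub>i c\<^sub>j = q c\<^sub>j c\<^sub>i\<close> for \<open>i < j\<close> says that sorting a word costs one factor \<open>q\<^sup>-\<^sup>1\<close>
  for every pair of letters that stands in the wrong order. So the combinatorics of the algebra
  is that of inversions, and of inversions between two factors of a product.\<close>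

fun inversions :: "nat list \<Rightarrow> nat"
  where
    "inversions [] = 0"
  | "inversions (x # u) = length (filter (\<lambda>y. y < x) u) + inversions u"

definition crossings :: "nat list \<Rightarrow> nat list \<Rightarrow> nat"
  where "crossings u v = (\<Sum>x\<leftarrow>u. length (filter (\<lambda>y. y < x) v))"

lemma crossings_simps [simp]:
  "crossings [] v = 0" "crossings u [] = 0"
  "crossings (x # u) v = length (filter (\<lambda>y. y < x) v) + crossings u v"
  "crossings (u @ u') v = crossings u v + crossings u' v"
  "crossings u (v @ v') = crossings u v + crossings u v'"
  by (simp_all add: crossings_def sum_list_addf)

lemma crossings_replicate [simp]:
  "crossings (replicate a x) (replicate b y) = (if y < x then a * b else 0)"
  by (induct a) auto

lemma inversions_append [simp]:
  "inversions (u @ v) = inversions u + inversions v + crossings u v"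
  by (induct u) auto

lemma inversions_sorted: "sorted u \<Longrightarrow> inversions u = 0"
  by (induct u) (auto simp: filter_empty_conv not_less)

lemma inversions_map_Suc [simp]: "inversions (map Suc u) = inversions u"
  by (induct u) (auto simp: filter_map comp_def)

text \<open>Bilinearity in the letter counts makes the number of crossings well defined modulo \<open>N\<close> when the
  counts are known only modulo \<open>N\<close>.\<close>

lemma crossings_eq_sum:
  assumes "finite A" "set u \<subseteq> A" "set v \<subseteq> A"
  shows "crossings u v = (\<Sum>x\<in>A. \<Sum>y\<in>A. if y < x then count_list u x * count_list v y else 0)"
proof -
  have "length (filter (\<lambda>y. y < x) v) = (\<Sum>y\<leftarrow>v. if y < x then 1 else 0)" for x
    by (induct v) auto
  then have "length (filter (\<lambda>y. y < x) v) = (\<Sum>y\<in>A. if y < x then count_list v y else 0)" for x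
    using sum_list_map_eq_sum_count2[OF assms(3,1), of "\<lambda>y. if y < x then 1 else 0"]
    by (simp add: if_distrib cong: if_cong)
  then show ?thesis
    unfolding crossings_def sum_list_map_eq_sum_count2[OF assms(2,1)]
    by (auto simp: sum_distrib_left intro!: sum.cong)
qed

lemma count_list_replicate [simp]: "count_list (replicate n x) y = (if x = y then n else 0)"
  by (induct n) auto

lemma count_list_concat_replicate:
  "count_list (concat (replicate k u)) i = k * count_list u i"
  by (induct k) auto

locale parafermions =
  fixes N :: nat
  assumes N_pos: "0 < N"
begin

text \<open>Words related by this congruence are those that the relations turn into each other up to a
  phase.\<close>

definition word_cong :: "nat list \<Rightarrow> nat list \<Rightarrow> bool"  (infix \<open>\<approx>\<^sub>N\<close> 50)
  where "u \<approx>\<^sub>N v \<longleftrightarrow> (\<forall>i. [count_list u i = count_list v i] (mod N))"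

lemma word_cong_refl [simp]: "u \<approx>\<^sub>N u"
  by (simp add: word_cong_def)

lemma word_cong_sym: "u \<approx>\<^sub>N v \<Longrightarrow> v \<approx>\<^sub>N u"
  by (simp add: word_cong_def cong_sym)

lemma word_cong_trans: "u \<approx>\<^sub>N v \<Longrightarrow> v \<approx>\<^sub>N w \<Longrightarrow> u \<approx>\<^sub>N w"
  unfolding word_cong_def using cong_trans by blast

lemma word_cong_left: "u \<approx>\<^sub>N v \<Longrightarrow> (w \<approx>\<^sub>N u) = (w \<approx>\<^sub>N v)"
  using word_cong_sym word_cong_trans by blast

lemma word_cong_append: "u \<approx>\<^sub>N u' \<Longrightarrow> v \<approx>\<^sub>N v' \<Longrightarrow> u @ v \<approx>\<^sub>N u' @ v'"
  by (simp add: word_cong_def cong_add)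

lemma word_cong_append_cancel [simp]:
  "w @ u \<approx>\<^sub>N w @ v \<longleftrightarrow> u \<approx>\<^sub>N v" "u @ w \<approx>\<^sub>N v @ w \<longleftrightarrow> u \<approx>\<^sub>N v"
  by (simp_all add: word_cong_def cong_add_lcancel_nat cong_add_rcancel_nat)

text \<open>Because \<open>c\<^sub>i\<^sup>N = 1\<close>, the power \<open>u\<^sup>N\<^sup>-\<^sup>1\<close> inverts \<open>u\<close> up to a power of \<open>q\<close>.\<close>

definition word_inverse :: "nat list \<Rightarrow> nat list"
  where "word_inverse u = concat (replicate (N - 1) u)"

lemma count_word_inverse: "count_list (word_inverse u) i + count_list u i = N * count_list u i"
proof -
  obtain n where "N = Suc n" using N_pos by (cases N) auto
  then show ?thesis unfolding word_inverse_def count_list_concat_replicate by simp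
qed

lemma word_inverse_cancel: "word_inverse u @ u \<approx>\<^sub>N []" "u @ word_inverse u \<approx>\<^sub>N []"
  using count_word_inverse by (simp_all add: word_cong_def cong_def add.commute)

lemma set_word_inverse: "set (word_inverse u) \<subseteq> set u"
  by (auto simp: word_inverse_def)

lemma crossings_cong:
  assumes "u \<approx>\<^sub>N u'" "v \<approx>\<^sub>N v'"
  shows "[crossings u v = crossings u' v'] (mod N)"
proof -
  define A where "A = set u \<union> set u' \<union> set v \<union> set v'"
  have "crossings u v = (\<Sum>x\<in>A. \<Sum>y\<in>A. if y < x then count_list u x * count_list v y else 0)"
       "crossings u' v' = (\<Sum>x\<in>A. \<Sum>y\<in>A. if y < x then count_list u' x * count_list v' y else 0)"
    by (rule crossings_eq_sum; auto simp: A_def)+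
  moreover have "[count_list u x * count_list v y = count_list u' x * count_list v' y] (mod N)" for x y
    using assms by (simp add: word_cong_def cong_mult)
  ultimately show ?thesis
    by (auto intro!: cong_sum)
qed

abbreviation q :: complex
  where "q \<equiv> pf_q N"

lemma q_nonzero [simp]: "q \<noteq> 0"
  by (simp add: pf_q_def)

lemma q_power_N: "q ^ N = 1"
proof -
  have "q ^ N = exp (of_nat N * (2 * of_real pi * \<i> / of_nat N))"
    unfolding pf_q_def by (rule exp_of_nat_mult[symmetric])
  also have "\<dots> = exp (2 * of_real pi * \<i>)"
    using N_pos by simp
  also have "\<dots> = 1"
    by (rule exp_two_pi_i)
  finally show ?thesis .
qed

lemma q_power_mod: "q ^ (n mod N) = q ^ n"
  by (metis div_mult_mod_eq mult.commute mult_1 power_add power_mult power_one q_power_N)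

lemma q_power_cong: "[a = b] (mod N) \<Longrightarrow> q ^ a = q ^ b"
  by (metis cong_def q_power_mod)

text \<open>The element \<open>phase u * u\<close> is the normally ordered monomial with the letters of \<open>u\<close>, because
  sorting \<open>u\<close> produces the inverse of this factor.\<close>

definition phase :: "nat list \<Rightarrow> complex"
  where "phase u = q ^ inversions u"

lemma phase_nonzero [simp]: "phase u \<noteq> 0"
  by (simp add: phase_def)

lemma phase_append: "phase (u @ v) = phase u * phase v * q ^ crossings u v"
  by (simp add: phase_def power_add)

lemma phase_sorted: "sorted u \<Longrightarrow> phase u = 1"
  by (simp add: phase_def inversions_sorted)

text \<open>Congruent words are exchanged with the same phase in every context, since the crossings with
  the context agree modulo \<open>N\<close> and \<open>q\<^sup>N = 1\<close>.\<close>

lemma phase_ratio_append_left: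
  "u \<approx>\<^sub>N v \<Longrightarrow> phase (w @ u) / phase (w @ v) = phase u / phase v"
  using q_power_cong[OF crossings_cong[of w w u v]] by (simp add: phase_append)

lemma phase_ratio_append_right:
  "u \<approx>\<^sub>N v \<Longrightarrow> phase (u @ w) / phase (v @ w) = phase u / phase v"
  using q_power_cong[OF crossings_cong[of u v w w]] by (simp add: phase_append)

end

section \<open>Words as elements of the free algebra\<close>

abbreviation wterm :: "nat list \<Rightarrow> complex \<Rightarrow> free_elem"
  where "wterm u a \<equiv> Poly_Mapping.single (Word u) a"

lemma wterm_mult: "wterm u a * wterm v b = wterm (u @ v) (a * b)"
  by (simp add: mult_single plus_gen_word_def)

lemma free_one_eq: "(1 :: free_elem) = wterm [] 1"
  by (simp add: zero_gen_word_def flip: single_one)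

lemma free_const_eq: "free_const a = wterm [] a"
  by (simp add: free_const_def zero_gen_word_def)

lemma free_gen_power: "free_gen i ^ n = wterm (replicate n i) 1"
  by (induct n) (simp_all add: free_one_eq free_gen_def wterm_mult)

lemma wterm_closed: "set u \<subseteq> {1..m} \<Longrightarrow> wterm u a \<in> carrier (free_alg m)"
  by (simp add: free_alg_def)

lemma free_elem_eq_sum:
  "p = (\<Sum>w\<in>Poly_Mapping.keys p. wterm (letters w) (Poly_Mapping.lookup p w))"
  by (rule poly_mapping_eqI) (auto simp: lookup_sum lookup_single when_def in_keys_iff)

lemma free_alg_induct [consumes 1, case_names word add]:
  assumes "p \<in> carrier (free_alg m)"
    and word: "\<And>u a. set u \<subseteq> {1..m} \<Longrightarrow> P (wterm u a)"
    and add: "\<And>p r. p \<in> carrier (free_alg m) \<Longrightarrow> r \<in> carrier (free_alg m) \<Longrightarrow> P p \<Longrightarrow> P r \<Longrightarrow> P (p + r)"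
  shows "P p"
proof -
  have "(\<Sum>w\<in>A. wterm (letters w) (Poly_Mapping.lookup p w)) \<in> carrier (free_alg m) \<and>
      P (\<Sum>w\<in>A. wterm (letters w) (Poly_Mapping.lookup p w))"
    if "finite A" "A \<subseteq> Poly_Mapping.keys p" for A
    using that
  proof (induct A)
    case empty
    then show ?case using word[of "[]" 0] by (simp add: free_alg_closed_zero)
  next
    case (insert w A)
    have "set (letters w) \<subseteq> {1..m}" using insert.prems assms(1) by (auto simp: free_alg_def)
    then show ?case
      using insert by (simp add: word add wterm_closed free_alg_closed_add del: gen_word.collapse)
  qed
  then show ?thesis by (metis finite_keys free_elem_eq_sum subset_refl)
qed

lemma free_elem_induct [case_names word add]:
  assumes word: "\<And>u a. P (wterm u a)" and add: "\<And>p r. P p \<Longrightarrow> P r \<Longrightarrow> P (p + r)"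
  shows "P (p :: free_elem)"
proof -
  have "P (\<Sum>w\<in>A. wterm (letters w) (Poly_Mapping.lookup p w))" if "finite A" for A
    using that word[of "[]" 0] by induct (simp_all add: word add del: gen_word.collapse)
  then show ?thesis by (metis finite_keys free_elem_eq_sum)
qed

definition word_extend :: "(nat list \<Rightarrow> complex \<Rightarrow> 'b) \<Rightarrow> free_elem \<Rightarrow> 'b::ab_group_add"
  where "word_extend f p = (\<Sum>w\<in>Poly_Mapping.keys p. f (letters w) (Poly_Mapping.lookup p w))"

context
  fixes f :: "nat list \<Rightarrow> complex \<Rightarrow> 'b::ab_group_add"
  assumes additive: "\<And>u a b. f u (a + b) = f u a + f u b"
begin

lemma word_extend_zero_coeff: "f u 0 = 0"
  using additive[of u 0 0] by simp

lemma word_extend_wterm: "word_extend f (wterm u a) = f u a"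
  by (simp add: word_extend_def word_extend_zero_coeff)

lemma word_extend_eq_sum:
  assumes "finite A" "Poly_Mapping.keys p \<subseteq> A"
  shows "word_extend f p = (\<Sum>w\<in>A. f (letters w) (Poly_Mapping.lookup p w))"
  unfolding word_extend_def using assms
  by (intro sum.mono_neutral_left) (auto simp: word_extend_zero_coeff in_keys_iff)

lemma word_extend_add: "word_extend f (p + r) = word_extend f p + word_extend f r"
proof -
  let ?A = "Poly_Mapping.keys p \<union> Poly_Mapping.keys r"
  have "Poly_Mapping.keys (p + r) \<subseteq> ?A" by (rule Poly_Mapping.keys_add)
  then show ?thesis
    by (simp add: word_extend_eq_sum[of ?A] additive lookup_add sum.distrib)
qed

end

section \<open>Coefficients that respect the relations\<close>

context parafermions
begin

text \<open>The coefficient of an element of the free algebra at the basis vector represented by \<open>u\<close>,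
  after all words congruent to \<open>u\<close> have been rewritten as multiples of \<open>u\<close>. Indexing by words
  instead of exponent vectors lets multiplication by a word act by concatenation
  (\<open>coef_mult_left\<close>, \<open>coef_mult_right\<close>).\<close>

definition coef :: "nat list \<Rightarrow> free_elem \<Rightarrow> complex"
  where "coef u = word_extend (\<lambda>w a. if w \<approx>\<^sub>N u then a * (phase u / phase w) else 0)"

lemma coef_wterm: "coef u (wterm w a) = (if w \<approx>\<^sub>N u then a * (phase u / phase w) else 0)"
  unfolding coef_def by (subst word_extend_wterm) (auto simp: field_simps)

lemma coef_add: "coef u (p + r) = coef u p + coef u r"
  unfolding coef_def by (subst word_extend_add) (auto simp: field_simps)

lemma coef_zero [simp]: "coef u 0 = 0"
  using coef_add[of u 0 0] by simp

lemma coef_uminus: "coef u (- p) = - coef u p"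
  using coef_add[of u p "- p"] by (simp add: eq_neg_iff_add_eq_0 add.commute)

lemma coef_diff: "coef u (p - r) = coef u p - coef u r"
  using coef_add[of u p "- r"] by (simp add: coef_uminus)

lemma coef_sum: "coef u (sum f A) = (\<Sum>x\<in>A. coef u (f x))"
  by (induct A rule: infinite_finite_induct) (simp_all add: coef_add)

lemma coef_const_mult: "coef u (free_const a * p) = a * coef u p"
  by (induct p rule: free_elem_induct)
    (simp_all add: free_const_eq wterm_mult coef_wterm coef_add distrib_left)

lemma coef_cong: "u \<approx>\<^sub>N v \<Longrightarrow> coef u p = phase u / phase v * coef v p"
  by (induct p rule: free_elem_induct)
    (simp_all add: coef_wterm coef_add distrib_left word_cong_left)

lemma coef_mult_left: "coef (w @ u) (wterm w a * p) = a * coef u p"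
  by (induct p rule: free_elem_induct)
    (simp_all add: wterm_mult coef_wterm coef_add distrib_left phase_ratio_append_left word_cong_sym)

lemma coef_mult_right: "coef (u @ w) (p * wterm w a) = a * coef u p"
  by (induct p rule: free_elem_induct)
    (simp_all add: wterm_mult coef_wterm coef_add algebra_simps phase_ratio_append_right word_cong_sym)

lemma word_cong_insert_inverse:
  "u \<approx>\<^sub>N w @ word_inverse w @ u" "u \<approx>\<^sub>N u @ word_inverse w @ w"
  using word_cong_append[OF word_inverse_cancel(2) word_cong_refl, of w u]
    word_cong_append[OF word_cong_refl word_inverse_cancel(1), of u w]
  by (auto intro: word_cong_sym)

text \<open>Multiplication by a word permutes the coefficients up to factors: a coefficient at \<open>u\<close>
  of the product is one at \<open>w\<^sup>-\<^sup>1 u\<close> of the other factor. Hence the common zeros of all coefficients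
  are closed under multiplication.\<close>

lemma coef_vanish_mult_left: "(\<And>u. coef u p = 0) \<Longrightarrow> coef u (r * p) = 0"
proof (induct r rule: free_elem_induct)
  case (word w a)
  then show ?case
    using coef_cong[OF word_cong_insert_inverse(1), of u "wterm w a * p" w]
    by (simp add: coef_mult_left)
qed (simp add: distrib_right coef_add)

lemma coef_vanish_mult_right: "(\<And>u. coef u p = 0) \<Longrightarrow> coef u (p * r) = 0"
proof (induct r rule: free_elem_induct)
  case (word w a)
  then show ?case
    using coef_cong[OF word_cong_insert_inverse(2), of u "p * wterm w a" w] coef_mult_right[of "u @ word_inverse w" w]
    by simp
qed (simp add: distrib_left coef_add)

lemma coef_relator:
  assumes "p \<in> pf_relators N m"
  shows "coef u p = 0"
  using assms unfolding pf_relators_def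
proof (elim UnE CollectE exE conjE)
  fix i assume p: "p = free_gen i ^ N - 1"
  have "replicate N i \<approx>\<^sub>N []" by (simp add: word_cong_def cong_def)
  moreover have "inversions (replicate N i) = 0" by (simp add: inversions_sorted)
  ultimately show ?thesis
    unfolding p free_gen_power free_one_eq coef_diff coef_wterm
    by (auto simp: phase_def dest: word_cong_trans word_cong_sym)
next
  fix i j :: nat assume p: "p = free_gen i * free_gen j - free_const q * (free_gen j * free_gen i)" and "i < j"
  have "[i, j] \<approx>\<^sub>N [j, i]" by (simp add: word_cong_def)
  then show ?thesis
    using \<open>i < j\<close> unfolding p free_gen_def coef_diff coef_const_mult wterm_mult coef_wterm
    by (auto simp: phase_def dest: word_cong_trans word_cong_sym)
qed

definition vanishing :: "nat \<Rightarrow> free_elem set"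
  where "vanishing m = {p \<in> carrier (free_alg m). \<forall>u. coef u p = 0}"

text \<open>This ideal contains the relators, so it contains the ideal that they generate, and the
  coefficients descend to the quotient. This replaces the construction of a model of the algebra
  in which the monomials are visibly independent.\<close>

lemma ideal_vanishing: "ideal (vanishing m) (free_alg m)"
proof (rule idealI[OF ring_free_alg])
  interpret ring "free_alg m" by (rule ring_free_alg)
  show "subgroup (vanishing m) (add_monoid (free_alg m))"
  proof (rule group.subgroupI[OF add.is_group])
    show "vanishing m \<noteq> {}" by (auto simp: vanishing_def intro!: exI[of _ 0] free_alg_closed_zero)
    fix p assume p: "p \<in> vanishing m"
    have "\<ominus>\<^bsub>free_alg m\<^esub> p = - p"
      using p minus_equality[of "- p" p]
      by (simp add: free_alg_sel vanishing_def free_alg_closed_uminus)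
    then show "inv\<^bsub>add_monoid (free_alg m)\<^esub> p \<in> vanishing m"
      using p by (simp add: a_inv_def vanishing_def free_alg_closed_uminus coef_uminus)
  qed (auto simp: vanishing_def free_alg_sel coef_add free_alg_closed_add)
qed (auto simp: vanishing_def free_alg_sel free_alg_closed_mult coef_vanish_mult_left coef_vanish_mult_right)

lemma coef_pf_ideal: "p \<in> pf_ideal N m \<Longrightarrow> coef u p = 0"
  using ring.genideal_minimal[OF ring_free_alg ideal_vanishing, of "pf_relators N m" m]
    coef_relator pf_relators_closed[of N m]
  unfolding pf_ideal_def vanishing_def by blast

end

section \<open>Classes in the parafermion algebra and their normal forms\<close>

lemma ideal_pf_ideal: "ideal (pf_ideal N m) (free_alg m)"
  unfolding pf_ideal_def by (rule ring.genideal_ideal[OF ring_free_alg pf_relators_closed])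

lemma pf_class_hom: "pf_class N m \<in> ring_hom (free_alg m) (PF N m)"
  using ideal.rcos_ring_hom[OF ideal_pf_ideal[of N m]] by (simp add: PF_def pf_class_def[abs_def])

lemma carrier_PF: "carrier (PF N m) = pf_class N m ` carrier (free_alg m)"
  by (auto simp: PF_def FactRing_def A_RCOSETS_def' pf_class_def)

lemma pf_class_closed: "p \<in> carrier (free_alg m) \<Longrightarrow> pf_class N m p \<in> carrier (PF N m)"
  by (simp add: carrier_PF)

lemma free_alg_minus:
  assumes "p \<in> carrier (free_alg m)" "r \<in> carrier (free_alg m)"
  shows "p \<ominus>\<^bsub>free_alg m\<^esub> r = p - r"
proof -
  interpret ring "free_alg m" by (rule ring_free_alg)
  have "\<ominus>\<^bsub>free_alg m\<^esub> r = - r"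
    using minus_equality[of "- r" r] assms(2) by (simp add: free_alg_sel free_alg_closed_uminus)
  then show ?thesis by (simp add: a_minus_def free_alg_sel)
qed

lemma pf_class_eq_iff_ideal:
  assumes "p \<in> carrier (free_alg m)" "r \<in> carrier (free_alg m)"
  shows "pf_class N m p = pf_class N m r \<longleftrightarrow> p - r \<in> pf_ideal N m"
  using ring.quotient_eq_iff_same_a_r_cos[OF ring_free_alg ideal_pf_ideal assms]
  by (simp add: pf_class_def free_alg_minus assms)

lemma pf_class_mult:
  "p \<in> carrier (free_alg m) \<Longrightarrow> r \<in> carrier (free_alg m) \<Longrightarrow>
    pf_class N m (p * r) = pf_class N m p \<otimes>\<^bsub>PF N m\<^esub> pf_class N m r"
  using ring_hom_mult[OF pf_class_hom[of N m]] by (simp add: free_alg_sel)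

lemma pf_class_add:
  "p \<in> carrier (free_alg m) \<Longrightarrow> r \<in> carrier (free_alg m) \<Longrightarrow>
    pf_class N m (p + r) = pf_class N m p \<oplus>\<^bsub>PF N m\<^esub> pf_class N m r"
  using ring_hom_add[OF pf_class_hom[of N m]] by (simp add: free_alg_sel)

lemma pf_class_one: "pf_class N m 1 = \<one>\<^bsub>PF N m\<^esub>"
  using ring_hom_one[OF pf_class_hom[of N m]] by (simp add: free_alg_sel)

lemma pf_class_zero: "pf_class N m 0 = \<zero>\<^bsub>PF N m\<^esub>"
  using ring_hom_zero[OF pf_class_hom[of N m] ring_free_alg ring_PF] by (simp add: free_alg_sel)

lemma free_const_closed: "free_const a \<in> carrier (free_alg m)"
  by (simp add: free_const_eq wterm_closed)

lemma free_gen_closed: "i \<in> {1..m} \<Longrightarrow> free_gen i \<in> carrier (free_alg m)"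
  by (simp add: free_gen_def wterm_closed)

lemma free_alg_closed_sum:
  "(\<And>x. x \<in> A \<Longrightarrow> f x \<in> carrier (free_alg m)) \<Longrightarrow> sum f A \<in> carrier (free_alg m)"
  by (induct A rule: infinite_finite_induct) (simp_all add: free_alg_closed_zero free_alg_closed_add)

lemma pf_smult_class:
  "p \<in> carrier (free_alg m) \<Longrightarrow> pf_smult N m a (pf_class N m p) = pf_class N m (free_const a * p)"
  by (simp add: pf_smult_def pf_const_def pf_class_mult free_const_closed)

lemma free_const_mult: "free_const a * (free_const b * p) = free_const (a * b) * p"
  by (simp add: free_const_eq wterm_mult flip: mult.assoc)

lemma free_const_mult_wterm: "free_const a * wterm u b = wterm u (a * b)"
  by (simp add: free_const_eq wterm_mult)

lemma pf_smult_wterm: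
  "set u \<subseteq> {1..m} \<Longrightarrow> pf_smult N m a (pf_class N m (wterm u b)) = pf_class N m (wterm u (a * b))"
  by (simp add: pf_smult_class wterm_closed free_const_mult_wterm)

lemma pf_class_wterm_mult:
  "set u \<subseteq> {1..m} \<Longrightarrow> set v \<subseteq> {1..m} \<Longrightarrow>
    pf_class N m (wterm u a) \<otimes>\<^bsub>PF N m\<^esub> pf_class N m (wterm v b) = pf_class N m (wterm (u @ v) (a * b))"
  by (simp add: wterm_mult wterm_closed flip: pf_class_mult)

lemma pf_class_finsum:
  assumes "finite A" "\<And>x. x \<in> A \<Longrightarrow> f x \<in> carrier (free_alg m)"
  shows "(\<Oplus>\<^bsub>PF N m\<^esub>x\<in>A. pf_class N m (f x)) = pf_class N m (sum f A)"
proof -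
  interpret ring "PF N m" by (rule ring_PF)
  show ?thesis
    using assms
    by (induct A) (auto simp: pf_class_zero pf_class_add free_alg_closed_sum pf_class_closed)
qed

lemma pf_class_sum_cong:
  assumes "\<And>x. x \<in> A \<Longrightarrow> f x \<in> carrier (free_alg m)" "\<And>x. x \<in> A \<Longrightarrow> g x \<in> carrier (free_alg m)"
    and "\<And>x. x \<in> A \<Longrightarrow> pf_class N m (f x) = pf_class N m (g x)"
  shows "pf_class N m (sum f A) = pf_class N m (sum g A)"
  using assms
  by (induct A rule: infinite_finite_induct) (simp_all add: pf_class_add free_alg_closed_sum)

lemma pf_gen_closed: "i \<in> {1..m} \<Longrightarrow> pf_gen N m i \<in> carrier (PF N m)"
  by (simp add: pf_gen_def pf_class_closed free_gen_closed)

lemma pf_gen_nat_pow: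
  assumes "i \<in> {1..m}"
  shows "pf_gen N m i [^]\<^bsub>PF N m\<^esub> (n::nat) = pf_class N m (wterm (replicate n i) 1)"
proof (induct n)
  case 0
  then show ?case by (simp add: free_one_eq flip: pf_class_one)
next
  case (Suc n)
  then show ?case
    using assms pf_class_wterm_mult[of "replicate n i" m "[i]" N 1 1]
    by (simp add: pf_gen_def free_gen_def replicate_append_same set_replicate_conv_if)
qed

definition sorted_word :: "nat \<Rightarrow> (nat \<Rightarrow> nat) \<Rightarrow> nat list"
  where "sorted_word m e = concat (map (\<lambda>i. replicate (e i) i) [1..<Suc m])"

lemma set_sorted_word: "set (sorted_word m e) \<subseteq> {1..m}"
  by (auto simp: sorted_word_def)

lemma sorted_sorted_word: "sorted (sorted_word m e)"
proof (induct m)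
  case (Suc m)
  have "sorted_word (Suc m) e = sorted_word m e @ replicate (e (Suc m)) (Suc m)"
    by (simp add: sorted_word_def)
  then show ?case
    using Suc set_sorted_word[of m e] by (auto simp: sorted_append)
qed (simp add: sorted_word_def)

lemma count_sorted_word: "count_list (sorted_word m e) i = (if i \<in> {1..m} then e i else 0)"
  by (induct m) (auto simp: sorted_word_def)

lemma pf_monom_eq: "pf_monom N m e = pf_class N m (wterm (sorted_word m e) 1)"
proof -
  have "foldr (\<lambda>i y. (pf_gen N m i [^]\<^bsub>PF N m\<^esub> e i) \<otimes>\<^bsub>PF N m\<^esub> y) xs \<one>\<^bsub>PF N m\<^esub>
      = pf_class N m (wterm (concat (map (\<lambda>i. replicate (e i) i) xs)) 1)"
    if "set xs \<subseteq> {1..m}" for xs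
    using that
  proof (induct xs)
    case Nil
    then show ?case by (simp add: free_one_eq flip: pf_class_one)
  next
    case (Cons x xs)
    have "set (concat (map (\<lambda>i. replicate (e i) i) xs)) \<subseteq> {1..m}"
      using Cons.prems by auto
    then show ?case
      using Cons pf_class_wterm_mult[of "replicate (e x) x" m "concat (map (\<lambda>i. replicate (e i) i) xs)" N 1 1]
      by (simp add: pf_gen_nat_pow set_replicate_conv_if)
  qed
  from this[of "[1..<Suc m]"] show ?thesis
    unfolding pf_monom_def sorted_word_def by (simp add: subset_iff del: upt_Suc)
qed

text \<open>A map on the free algebra that is constant on classes induces an extensional map on the
  quotient; extensionality matches the \<open>THE\<close> in the definitions of the structure maps.\<close>

definition pf_induced :: "nat \<Rightarrow> nat \<Rightarrow> (free_elem \<Rightarrow> 'b) \<Rightarrow> free_elem set \<Rightarrow> 'b"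
  where "pf_induced N m f = restrict
    (\<lambda>x. f (SOME p. p \<in> carrier (free_alg m) \<and> pf_class N m p = x)) (carrier (PF N m))"

lemma pf_induced_class:
  assumes "\<And>p r. p \<in> carrier (free_alg m) \<Longrightarrow> r \<in> carrier (free_alg m) \<Longrightarrow>
      pf_class N m p = pf_class N m r \<Longrightarrow> f p = f r"
    and "p \<in> carrier (free_alg m)"
  shows "pf_induced N m f (pf_class N m p) = f p"
proof -
  let ?p = "SOME r. r \<in> carrier (free_alg m) \<and> pf_class N m r = pf_class N m p"
  have p: "?p \<in> carrier (free_alg m) \<and> pf_class N m ?p = pf_class N m p"
    by (rule someI[of _ p]) (simp add: assms(2))
  have "f ?p = f p"
    by (rule assms(1)[OF conjunct1[OF p] assms(2) conjunct2[OF p]])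
  then show ?thesis
    by (simp add: pf_induced_def pf_class_closed[OF assms(2)])
qed

lemma pf_induced_extensional: "pf_induced N m f \<in> extensional (carrier (PF N m))"
  by (simp add: pf_induced_def)

context parafermions
begin

abbreviation same_class :: "nat \<Rightarrow> nat list \<Rightarrow> nat list \<Rightarrow> bool"
  where "same_class m u v \<equiv> pf_class N m (wterm u (phase u)) = pf_class N m (wterm v (phase v))"

lemma same_class_context:
  assumes "same_class m u v" "u \<approx>\<^sub>N v"
    and "set a \<subseteq> {1..m}" "set b \<subseteq> {1..m}" "set u \<subseteq> {1..m}" "set v \<subseteq> {1..m}"
  shows "same_class m (a @ u @ b) (a @ v @ b)"
proof -
  \<comment> \<open>The factor by which the normal ordering of the context changes the phase; it is the same for \<open>u\<close> and \<open>v\<close>.\<close>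
  define c where "c = phase (a @ u @ b) / phase u"
  have "phase (a @ u @ b) / phase (a @ v @ b) = phase u / phase v"
    using phase_ratio_append_left[of "u @ b" "v @ b" a] phase_ratio_append_right[OF assms(2), of b]
    by (simp add: assms(2))
  then have c: "phase (a @ u @ b) = c * phase u" "phase (a @ v @ b) = c * phase v"
    by (simp_all add: c_def divide_simps)
  have *: "pf_class N m (wterm (a @ w @ b) (c * phase w)) =
      pf_class N m (wterm a c) \<otimes>\<^bsub>PF N m\<^esub> (pf_class N m (wterm w (phase w)) \<otimes>\<^bsub>PF N m\<^esub> pf_class N m (wterm b 1))"
    if "set w \<subseteq> {1..m}" for w
    using that assms by (simp add: pf_class_wterm_mult)
  show ?thesis
    unfolding c *[OF assms(5)] *[OF assms(6)] assms(1) ..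
qed

lemma pf_class_relator:
  assumes "p - r \<in> pf_relators N m" "p \<in> carrier (free_alg m)" "r \<in> carrier (free_alg m)"
  shows "pf_class N m p = pf_class N m r"
  unfolding pf_class_eq_iff_ideal[OF assms(2,3)] pf_ideal_def
  using ring.genideal_self[OF ring_free_alg pf_relators_closed] assms(1) by blast

lemma same_class_swap:
  assumes "i \<in> {1..m}" "j \<in> {1..m}"
  shows "same_class m [i, j] [j, i]"
proof -
  have *: "same_class m [i, j] [j, i]" if "i \<in> {1..m}" "j \<in> {1..m}" "i < j" for i j
  proof (rule pf_class_relator)
    have "wterm [i, j] (phase [i, j]) - wterm [j, i] (phase [j, i])
        = free_gen i * free_gen j - free_const q * (free_gen j * free_gen i)"
      using that by (simp add: free_gen_def free_const_eq wterm_mult phase_def)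
    then show "wterm [i, j] (phase [i, j]) - wterm [j, i] (phase [j, i]) \<in> pf_relators N m"
      unfolding pf_relators_def using that by blast
  qed (use that in \<open>simp_all add: wterm_closed\<close>)
  show ?thesis
    using *[of i j] *[of j i] assms by (cases i j rule: linorder_cases) simp_all
qed

lemma same_class_replicate_N:
  assumes "i \<in> {1..m}"
  shows "same_class m (replicate N i) []"
proof (rule pf_class_relator)
  show "wterm (replicate N i) (phase (replicate N i)) - wterm [] (phase []) \<in> pf_relators N m"
    unfolding pf_relators_def using assms
    by (auto simp: free_gen_power phase_sorted free_one_eq)
qed (use assms in \<open>simp_all add: wterm_closed set_replicate_conv_if\<close>)

lemma word_cong_mset: "mset u = mset v \<Longrightarrow> u \<approx>\<^sub>N v"
  by (metis count_mset word_cong_def cong_refl)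

lemma same_class_move:
  "x \<in> {1..m} \<Longrightarrow> set a \<subseteq> {1..m} \<Longrightarrow> same_class m (x # a) (a @ [x])"
proof (induct a)
  case (Cons y a)
  have "same_class m (x # y # a) (y # x # a)"
    using Cons same_class_context[OF same_class_swap[of x m y], of "[]" a]
    by (simp add: word_cong_mset)
  also have "same_class m (y # x # a) (y # a @ [x])"
    using Cons same_class_context[of m "x # a" "a @ [x]" "[y]" "[]"]
    by (simp add: word_cong_mset)
  finally show ?case by simp
qed simp

lemma same_class_mset:
  "mset u = mset v \<Longrightarrow> set u \<subseteq> {1..m} \<Longrightarrow> same_class m u v"
proof (induct u arbitrary: v)
  case (Cons x u)
  then obtain a b where v: "v = a @ x # b"
    by (metis list.set_intros(1) mset_eq_setD split_list)
  have sets: "set a \<subseteq> {1..m}" "set b \<subseteq> {1..m}" "x \<in> {1..m}" "set u \<subseteq> {1..m}"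
    using mset_eq_setD[OF Cons.prems(1)] Cons.prems(2) v by auto
  have "mset u = mset (a @ b)" using Cons.prems(1) v by simp
  then have "same_class m (x # u) (x # a @ b)"
    using Cons.hyps[of "a @ b"] sets same_class_context[of m u "a @ b" "[x]" "[]"]
    by (simp add: word_cong_mset)
  also have "same_class m (x # a @ b) (a @ x # b)"
    using sets same_class_context[OF same_class_move[of x m a], of "[]" b]
    by (simp add: word_cong_mset)
  finally show ?case using v by simp
qed simp

text \<open>Any \<open>N\<close> equal letters can be brought to the front and removed, because \<open>c\<^sub>i\<^sup>N = 1\<close>.\<close>

lemma same_class_reduce:
  "set u \<subseteq> {1..m} \<Longrightarrow>
    \<exists>v. set v \<subseteq> {1..m} \<and> same_class m u v \<and> u \<approx>\<^sub>N v \<and> (\<forall>i. count_list v i < N)"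
proof (induct "length u" arbitrary: u rule: less_induct)
  case less
  show ?case
  proof (cases "\<forall>i. count_list u i < N")
    case True
    then show ?thesis using less.prems by (auto intro!: exI[of _ u])
  next
    case False
    then obtain i where i: "N \<le> count_list u i" by (auto simp: not_less)
    then have "replicate_mset N i \<subseteq># mset u"
      by (simp add: count_mset flip: count_le_replicate_mset_subset_eq)
    then obtain w where w: "mset u = mset (replicate N i @ w)"
      by (metis ex_mset mset_append mset_replicate subset_mset.add_diff_inverse)
    have sets: "i \<in> {1..m}" "set w \<subseteq> {1..m}"
      using mset_eq_setD[OF w] less.prems N_pos by auto
    have "same_class m u (replicate N i @ w)"
      using same_class_mset[OF w less.prems] .
    also have "same_class m (replicate N i @ w) w"
      using same_class_context[OF same_class_replicate_N[of i m], of "[]" w] sets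
      by (simp add: word_cong_def cong_def set_replicate_conv_if)
    finally have uw: "same_class m u w" .
    have "replicate N i @ w \<approx>\<^sub>N w" by (simp add: word_cong_def cong_def)
    then have uw': "u \<approx>\<^sub>N w"
      using word_cong_mset[OF w] word_cong_trans by blast
    have "length w < length u" using arg_cong[OF w, of size] N_pos by simp
    from less.hyps[OF this sets(2)] obtain v where
      v: "set v \<subseteq> {1..m}" "same_class m w v" "w \<approx>\<^sub>N v" "\<forall>i. count_list v i < N"
      by blast
    have "u \<approx>\<^sub>N v" using uw' v(3) by (rule word_cong_trans)
    then show ?thesis using uw v by (intro exI[of _ v]) simp
  qed
qed

text \<open>Reduced congruent words have equal letter counts, hence are permutations of each other, and
  permuting letters preserves the normally ordered monomial.\<close>

lemma same_class_word_cong: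
  assumes "u \<approx>\<^sub>N v" "set u \<subseteq> {1..m}" "set v \<subseteq> {1..m}"
  shows "same_class m u v"
proof -
  obtain u' where
    u': "set u' \<subseteq> {1..m}" "same_class m u u'" "u \<approx>\<^sub>N u'" "\<forall>i. count_list u' i < N"
    using same_class_reduce[OF assms(2)] by blast
  obtain v' where
    v': "set v' \<subseteq> {1..m}" "same_class m v v'" "v \<approx>\<^sub>N v'" "\<forall>i. count_list v' i < N"
    using same_class_reduce[OF assms(3)] by blast
  have "u' \<approx>\<^sub>N v'" using assms(1) u'(3) v'(3) word_cong_sym word_cong_trans by blast
  then have "count_list u' i = count_list v' i" for i
    using u'(4) v'(4) by (simp add: word_cong_def cong_def)
  then have "mset u' = mset v'" by (intro multiset_eqI) (simp add: count_mset)
  then show ?thesis using same_class_mset[of u' v' m] u' v' by simp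
qed

lemma pf_class_wterm_cong:
  assumes "u \<approx>\<^sub>N v" "set u \<subseteq> {1..m}" "set v \<subseteq> {1..m}"
  shows "pf_class N m (wterm u a) = pf_class N m (wterm v (a * (phase v / phase u)))"
  using arg_cong[OF same_class_word_cong[OF assms], of "pf_smult N m (a / phase u)"] assms
  by (simp add: pf_smult_wterm)

text \<open>The representative that is a combination of basis monomials of \<open>m\<close> generators. Applied to an
  element with more generators it drops the monomials that involve the others, so this single map
  also serves as the conditional expectation on representatives.\<close>

definition normal_form :: "nat \<Rightarrow> free_elem \<Rightarrow> free_elem"
  where "normal_form m p =
    (\<Sum>e\<in>pf_exponents N m. wterm (sorted_word m e) (coef (sorted_word m e) p))"

lemma normal_form_add: "normal_form m (p + r) = normal_form m p + normal_form m r"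
  by (simp add: normal_form_def coef_add single_add sum.distrib)

lemma normal_form_closed: "normal_form m p \<in> carrier (free_alg m)"
  unfolding normal_form_def by (intro free_alg_closed_sum wterm_closed set_sorted_word)

lemma finite_pf_exponents: "finite (pf_exponents N m)"
  by (simp add: pf_exponents_def finite_PiE)

definition word_exponents :: "nat \<Rightarrow> nat list \<Rightarrow> nat \<Rightarrow> nat"
  where "word_exponents m u = (\<lambda>i\<in>{1..m}. count_list u i mod N)"

lemma word_exponents_in: "word_exponents m u \<in> pf_exponents N m"
  using N_pos by (auto simp: word_exponents_def pf_exponents_def)

lemma sorted_word_exponents:
  assumes "set u \<subseteq> {1..m}"
  shows "sorted_word m (word_exponents m u) \<approx>\<^sub>N u"
  unfolding word_cong_def
proof
  fix i show "[count_list (sorted_word m (word_exponents m u)) i = count_list u i] (mod N)"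
    using count_notin[of i u] assms
    by (cases "i \<in> {1..m}")
      (simp add: count_sorted_word word_exponents_def, force simp: count_sorted_word)
qed

lemma word_exponents_unique:
  assumes "e \<in> pf_exponents N m" "u \<approx>\<^sub>N sorted_word m e"
  shows "e = word_exponents m u"
proof
  fix i show "e i = word_exponents m u i"
  proof (cases "i \<in> {1..m}")
    case True
    then have "[count_list u i = e i] (mod N)" "e i < N"
      using assms by (auto simp: word_cong_def count_sorted_word pf_exponents_def split: if_splits dest!: spec[of _ i])
    then show ?thesis using True by (auto simp: word_exponents_def cong_def)
  next
    case False
    then show ?thesis using assms(1) by (auto simp: word_exponents_def pf_exponents_def)
  qed
qed

text \<open>The spanning half of the basis theorem for the monomials.\<close>

lemma pf_class_normal_form:
  assumes "p \<in> carrier (free_alg m)"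
  shows "pf_class N m (normal_form m p) = pf_class N m p"
  using assms
proof (induct p rule: free_alg_induct)
  case (word u a)
  let ?e = "word_exponents m u"
  have "coef (sorted_word m e) (wterm u a) = 0" if "e \<in> pf_exponents N m - {?e}" for e
    using that word_exponents_unique[of e m u] by (auto simp: coef_wterm)
  then have "normal_form m (wterm u a) = wterm (sorted_word m ?e) (coef (sorted_word m ?e) (wterm u a))"
    unfolding normal_form_def
    using word_exponents_in by (subst sum.remove[OF finite_pf_exponents, of ?e]) simp_all
  also have "pf_class N m \<dots> = pf_class N m (wterm u a)"
    using pf_class_wterm_cong[of u "sorted_word m ?e" m a] sorted_word_exponents[OF word]
      word set_sorted_word
    by (simp add: coef_wterm word_cong_sym)
  finally show ?case .
qed (simp add: normal_form_add pf_class_add normal_form_closed)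

lemma coef_eq_if_pf_class_eq:
  assumes "p \<in> carrier (free_alg m)" "r \<in> carrier (free_alg m)" "pf_class N m p = pf_class N m r"
  shows "coef u p = coef u r"
  using coef_pf_ideal[of "p - r" m u] assms(3) pf_class_eq_iff_ideal[OF assms(1,2)]
  by (simp add: coef_diff)

text \<open>The solution of the word problem: the monomials span, and the coefficients show that they are
  independent. Everything about the quotient can thus be checked on representatives.\<close>

theorem pf_class_eq_iff:
  assumes "p \<in> carrier (free_alg m)" "r \<in> carrier (free_alg m)"
  shows "pf_class N m p = pf_class N m r \<longleftrightarrow> (\<forall>u. coef u p = coef u r)"
proof
  assume "\<forall>u. coef u p = coef u r"
  then have "normal_form m p = normal_form m r" by (simp add: normal_form_def)
  then show "pf_class N m p = pf_class N m r" 
    using pf_class_normal_form[OF assms(1)] pf_class_normal_form[OF assms(2)] by simp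
qed (simp add: coef_eq_if_pf_class_eq[OF assms])

end

section \<open>The trace\<close>

lemma PF_cases:
  assumes "x \<in> carrier (PF N m)"
  obtains p where "p \<in> carrier (free_alg m)" "x = pf_class N m p"
  using assms by (auto simp: carrier_PF)

lemma PF_induct_word [consumes 1, case_names word add]:
  assumes "x \<in> carrier (PF N m)"
    and word: "\<And>u a. set u \<subseteq> {1..m} \<Longrightarrow> P (pf_class N m (wterm u a))"
    and add: "\<And>x y. x \<in> carrier (PF N m) \<Longrightarrow> y \<in> carrier (PF N m) \<Longrightarrow> P x \<Longrightarrow> P y \<Longrightarrow> P (x \<oplus>\<^bsub>PF N m\<^esub> y)"
  shows "P x"
proof -
  obtain p where p: "p \<in> carrier (free_alg m)" and x: "x = pf_class N m p"
    using assms(1) by (rule PF_cases)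
  from p have "P (pf_class N m p)"
    by (induct p rule: free_alg_induct) (simp_all add: word add pf_class_add pf_class_closed)
  then show ?thesis by (simp only: x)
qed

lemma pf_monom_closed: "pf_monom N m e \<in> carrier (PF N m)"
  by (simp only: pf_monom_eq) (intro pf_class_closed wterm_closed set_sorted_word)

context parafermions
begin

lemma PF_induct_monom [consumes 1, case_names monom add]:
  assumes "x \<in> carrier (PF N m)"
    and monom: "\<And>e a. e \<in> pf_exponents N m \<Longrightarrow> P (pf_smult N m a (pf_monom N m e))"
    and add: "\<And>x y. x \<in> carrier (PF N m) \<Longrightarrow> y \<in> carrier (PF N m) \<Longrightarrow> P x \<Longrightarrow> P y \<Longrightarrow> P (x \<oplus>\<^bsub>PF N m\<^esub> y)"
  shows "P x"
  using assms(1)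
proof (induct x rule: PF_induct_word)
  case (word u a)
  let ?e = "word_exponents m u"
  have "pf_class N m (wterm u a) = pf_smult N m (a * (phase (sorted_word m ?e) / phase u)) (pf_monom N m ?e)"
    using pf_class_wterm_cong[OF word_cong_sym[OF sorted_word_exponents[OF word]] word set_sorted_word, of a]
      pf_smult_wterm[OF set_sorted_word[of m ?e], of N _ 1]
    by (simp add: pf_monom_eq)
  then show ?case using monom[OF word_exponents_in] by simp
qed (rule add)

lemma normal_form_eq_if_pf_class_eq:
  assumes "p \<in> carrier (free_alg n)" "r \<in> carrier (free_alg n)" "pf_class N n p = pf_class N n r"
  shows "normal_form m p = normal_form m r"
  unfolding normal_form_def using coef_eq_if_pf_class_eq[OF assms] by simp

lemma pf_class_eqI:
  assumes "p \<in> carrier (free_alg m)" "r \<in> carrier (free_alg m)"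
    and "\<And>e. e \<in> pf_exponents N m \<Longrightarrow> coef (sorted_word m e) p = coef (sorted_word m e) r"
  shows "pf_class N m p = pf_class N m r"
proof -
  have "normal_form m p = normal_form m r"
    unfolding normal_form_def using assms(3) by (auto intro: sum.cong)
  then show ?thesis
    using pf_class_normal_form[OF assms(1)] pf_class_normal_form[OF assms(2)] by simp
qed

text \<open>Exactly one basis monomial is congruent to \<open>u\<close>, namely the one with the exponents of \<open>u\<close>.\<close>

lemma coef_normal_form:
  assumes "set u \<subseteq> {1..m}"
  shows "coef u (normal_form m p) = coef u p"
proof -
  let ?e = "word_exponents m u"
  have "coef u (wterm (sorted_word m e) (coef (sorted_word m e) p)) = 0"
    if "e \<in> pf_exponents N m - {?e}" for e
    using that word_exponents_unique[of e m u] word_cong_sym by (auto simp: coef_wterm)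
  then have "coef u (normal_form m p) = coef u (wterm (sorted_word m ?e) (coef (sorted_word m ?e) p))"
    unfolding normal_form_def coef_sum
    using word_exponents_in by (subst sum.remove[OF finite_pf_exponents, of ?e]) simp_all
  also have "\<dots> = coef u p"
    using sorted_word_exponents[OF assms] coef_cong[OF word_cong_sym[OF sorted_word_exponents[OF assms]], of p]
    by (simp add: coef_wterm)
  finally show ?thesis .
qed

definition trace :: "nat \<Rightarrow> free_elem set \<Rightarrow> complex"
  where "trace m = pf_induced N m (coef [])"

lemma trace_class: "p \<in> carrier (free_alg m) \<Longrightarrow> trace m (pf_class N m p) = coef [] p"
  unfolding trace_def by (rule pf_induced_class) (rule coef_eq_if_pf_class_eq)

lemma trace_add:
  "x \<in> carrier (PF N m) \<Longrightarrow> y \<in> carrier (PF N m) \<Longrightarrow> trace m (x \<oplus>\<^bsub>PF N m\<^esub> y) = trace m x + trace m y"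
  by (auto elim!: PF_cases simp: trace_class coef_add free_alg_closed_add simp flip: pf_class_add)

lemma trace_smult: "x \<in> carrier (PF N m) \<Longrightarrow> trace m (pf_smult N m a x) = a * trace m x"
  by (auto elim!: PF_cases simp: trace_class coef_const_mult pf_smult_class free_alg_closed_mult free_const_closed)

lemma trace_monom:
  assumes "e \<in> pf_exponents N m"
  shows "trace m (pf_monom N m e) = (if \<forall>i\<in>{1..m}. e i = 0 then 1 else 0)"
proof -
  have lt: "e i < N" if "i \<in> {1..m}" for i
    using assms that by (auto simp: pf_exponents_def)
  have "sorted_word m e \<approx>\<^sub>N [] \<longleftrightarrow> (\<forall>i\<in>{1..m}. e i = 0)"
    using lt by (auto simp: word_cong_def count_sorted_word cong_def)
  then show ?thesis
    unfolding pf_monom_eq trace_class[OF wterm_closed[OF set_sorted_word]]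
    by (simp add: coef_wterm phase_sorted sorted_sorted_word)
qed

text \<open>Existence holds because the coefficients respect the relations, uniqueness because the monomials
  span.\<close>

lemma pf_tr_eq: "pf_tr N m = trace m"
  unfolding pf_tr_def
proof (rule the_equality)
  fix t
  assume t: "t \<in> extensional (carrier (PF N m)) \<and>
    (\<forall>x\<in>carrier (PF N m). \<forall>y\<in>carrier (PF N m). t (x \<oplus>\<^bsub>PF N m\<^esub> y) = t x + t y) \<and>
    (\<forall>a. \<forall>x\<in>carrier (PF N m). t (pf_smult N m a x) = a * t x) \<and>
    (\<forall>e\<in>pf_exponents N m. t (pf_monom N m e) = (if \<forall>i\<in>{1..m}. e i = 0 then 1 else 0))"
  show "t = trace m"
  proof (rule extensionalityI)
    fix x assume "x \<in> carrier (PF N m)"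
    then show "t x = trace m x"
      by (induct x rule: PF_induct_monom)
        (use t in \<open>simp_all add: trace_add trace_smult trace_monom pf_monom_closed\<close>)
  qed (use t in \<open>auto simp: trace_def pf_induced_extensional\<close>)
qed (simp add: trace_add trace_smult trace_monom, simp add: trace_def pf_induced_extensional)

text \<open>Multiplying by the inverse of the word \<open>u\<close> moves the coefficient at \<open>u\<close> to the empty word. So
  the trace recovers all coefficients; this is what makes the conditional expectation unique.\<close>

lemma trace_nondegenerate:
  assumes "x \<in> carrier (PF N m)" "y \<in> carrier (PF N m)"
    and "\<And>b. b \<in> carrier (PF N m) \<Longrightarrow> trace m (b \<otimes>\<^bsub>PF N m\<^esub> x) = trace m (b \<otimes>\<^bsub>PF N m\<^esub> y)"
  shows "x = y"
proof -
  obtain p r where p: "p \<in> carrier (free_alg m)" "x = pf_class N m p"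
    and r: "r \<in> carrier (free_alg m)" "y = pf_class N m r"
    using assms(1,2) by (auto elim!: PF_cases)
  have "coef u p = coef u r" if u: "set u \<subseteq> {1..m}" for u
  proof -
    let ?b = "wterm (word_inverse u) 1"
    have b: "?b \<in> carrier (free_alg m)"
      using u set_word_inverse[of u] by (intro wterm_closed) blast
    have "coef [] (?b * z) = phase [] / phase (word_inverse u @ u) * coef u z" for z
      using coef_cong[OF word_cong_sym[OF word_inverse_cancel(1)[of u]], of "?b * z"]
      by (simp add: coef_mult_left)
    moreover have "coef [] (?b * p) = coef [] (?b * r)"
      using assms(3)[of "pf_class N m ?b"] p r b
      by (simp add: pf_class_closed trace_class free_alg_closed_mult flip: pf_class_mult)
    ultimately show ?thesis by simp
  qed
  then show ?thesis
    using p r pf_class_eqI[of p m r] set_sorted_word by simp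
qed

section \<open>Inclusion and left shift\<close>

text \<open>Carries the uniqueness of homomorphisms with given values on the generators, since \<open>h\<close> enters the
  right-hand side only through these values.\<close>

lemma pf_alg_hom_word:
  assumes "pf_alg_hom N m n h" "set u \<subseteq> {1..m}"
  shows "h (pf_class N m (wterm u a)) =
    foldr (\<lambda>i y. h (pf_gen N m i) \<otimes>\<^bsub>PF N n\<^esub> y) u (pf_smult N n a \<one>\<^bsub>PF N n\<^esub>)"
  using assms(2)
proof (induct u)
  case Nil
  have "pf_class N m (wterm [] a) = pf_smult N m a \<one>\<^bsub>PF N m\<^esub>"
    using pf_smult_wterm[of "[]" m N a 1] by (simp add: free_one_eq flip: pf_class_one)
  moreover have "\<one>\<^bsub>PF N m\<^esub> \<in> carrier (PF N m)" by (rule monoid.one_closed[OF ring.is_monoid[OF ring_PF]])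
  moreover have "h \<one>\<^bsub>PF N m\<^esub> = \<one>\<^bsub>PF N n\<^esub>"
    using assms(1) ring_hom_one by (auto simp: pf_alg_hom_def)
  ultimately show ?case using assms(1) by (simp add: pf_alg_hom_def)
next
  case (Cons x u)
  have "pf_class N m (wterm (x # u) a) = pf_gen N m x \<otimes>\<^bsub>PF N m\<^esub> pf_class N m (wterm u a)"
    using Cons.prems pf_class_wterm_mult[of "[x]" m u N 1 a] by (simp add: pf_gen_def free_gen_def)
  moreover have "h \<in> ring_hom (PF N m) (PF N n)" using assms(1) by (simp add: pf_alg_hom_def)
  ultimately show ?case
    using Cons ring_hom_mult[of h "PF N m" "PF N n" "pf_gen N m x" "pf_class N m (wterm u a)"]
    by (simp add: pf_gen_closed pf_class_closed wterm_closed)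
qed

lemma pf_alg_hom_unique:
  assumes h: "pf_alg_hom N m n h" and h': "pf_alg_hom N m n h'"
    and gen: "\<And>i. i \<in> {1..m} \<Longrightarrow> h (pf_gen N m i) = h' (pf_gen N m i)"
    and "x \<in> carrier (PF N m)"
  shows "h x = h' x"
  using assms(4)
proof (induct x rule: PF_induct_word)
  case (word u a)
  then show ?case
    unfolding pf_alg_hom_word[OF h word] pf_alg_hom_word[OF h' word]
    by (induct u) (simp_all add: gen)
next
  case (add x y)
  moreover have "h \<in> ring_hom (PF N m) (PF N n)" "h' \<in> ring_hom (PF N m) (PF N n)"
    using h h' by (simp_all add: pf_alg_hom_def)
  ultimately show ?case by (simp add: ring_hom_add)
qed

lemma pf_alg_hom_induced:
  fixes F :: "free_elem \<Rightarrow> free_elem"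
  assumes closed: "\<And>p. p \<in> carrier (free_alg m) \<Longrightarrow> F p \<in> carrier (free_alg n)"
    and add: "\<And>p r. F (p + r) = F p + F r" and mult: "\<And>p r. F (p * r) = F p * F r"
    and const: "\<And>a. F (free_const a) = free_const a"
    and cong: "\<And>p r. p \<in> carrier (free_alg m) \<Longrightarrow> r \<in> carrier (free_alg m) \<Longrightarrow>
      pf_class N m p = pf_class N m r \<Longrightarrow> pf_class N n (F p) = pf_class N n (F r)"
  shows "pf_alg_hom N m n (pf_induced N m (\<lambda>p. pf_class N n (F p)))" (is "pf_alg_hom N m n ?h")
proof -
  have h: "?h (pf_class N m p) = pf_class N n (F p)" if "p \<in> carrier (free_alg m)" for p
    using cong that by (rule pf_induced_class)
  show "pf_alg_hom N m n ?h"
    unfolding pf_alg_hom_def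
  proof (intro conjI ring_hom_memI allI ballI)
    fix x assume "x \<in> carrier (PF N m)"
    then show "?h x \<in> carrier (PF N n)" by (auto elim!: PF_cases simp: h closed pf_class_closed)
  next
    fix x y assume "x \<in> carrier (PF N m)" "y \<in> carrier (PF N m)"
    then show "?h (x \<otimes>\<^bsub>PF N m\<^esub> y) = ?h x \<otimes>\<^bsub>PF N n\<^esub> ?h y"
      by (auto elim!: PF_cases simp: h closed mult free_alg_closed_mult simp flip: pf_class_mult)
  next
    fix x y assume "x \<in> carrier (PF N m)" "y \<in> carrier (PF N m)"
    then show "?h (x \<oplus>\<^bsub>PF N m\<^esub> y) = ?h x \<oplus>\<^bsub>PF N n\<^esub> ?h y"
      by (auto elim!: PF_cases simp: h closed add free_alg_closed_add simp flip: pf_class_add)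
  next
    have "free_const 1 = 1" by (simp add: free_const_def)
    then show "?h \<one>\<^bsub>PF N m\<^esub> = \<one>\<^bsub>PF N n\<^esub>"
      using const[of 1] by (simp add: h free_alg_closed_one flip: pf_class_one)
  next
    fix a x assume "x \<in> carrier (PF N m)"
    then show "?h (pf_smult N m a x) = pf_smult N n a (?h x)"
      by (auto elim!: PF_cases simp: h closed pf_smult_class mult const free_alg_closed_mult free_const_closed)
  qed
qed

lemma free_alg_mono: "p \<in> carrier (free_alg m) \<Longrightarrow> p \<in> carrier (free_alg (Suc m))"
  by (force simp: free_alg_def)

lemma pf_class_eq_Suc:
  assumes "p \<in> carrier (free_alg m)" "r \<in> carrier (free_alg m)" "pf_class N m p = pf_class N m r"
  shows "pf_class N (Suc m) p = pf_class N (Suc m) r"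
  using assms by (simp add: pf_class_eq_iff free_alg_mono)

lemma pf_incl_eq: "pf_incl N m = pf_induced N m (pf_class N (Suc m))"
  (is "_ = ?h")
proof -
  have h: "pf_alg_hom N m (Suc m) ?h"
    by (rule pf_alg_hom_induced[of m "\<lambda>p. p"])
      (rule refl | erule free_alg_mono | erule (2) pf_class_eq_Suc)+
  have hc: "?h (pf_class N m p) = pf_class N (Suc m) p" if "p \<in> carrier (free_alg m)" for p
    using pf_class_eq_Suc that by (rule pf_induced_class)
  have gen: "?h (pf_gen N m i) = pf_gen N (Suc m) i" if "i \<in> {1..m}" for i
    using hc[OF free_gen_closed[OF that]] by (simp add: pf_gen_def)
  show ?thesis
    unfolding pf_incl_def
  proof (rule the_equality)
    fix h'
    assume h': "h' \<in> extensional (carrier (PF N m)) \<and> pf_alg_hom N m (m + 1) h' \<and>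
      (\<forall>i\<in>{1..m}. h' (pf_gen N m i) = pf_gen N (m + 1) i)"
    show "h' = ?h"
      by (rule extensionalityI[of _ "carrier (PF N m)"], use h' in simp, rule pf_induced_extensional)
        (rule pf_alg_hom_unique[of m "Suc m"], use h' h gen in simp_all)
  qed (use h gen in \<open>simp add: pf_induced_extensional\<close>)
qed

lemma pf_incl_class: "p \<in> carrier (free_alg m) \<Longrightarrow> pf_incl N m (pf_class N m p) = pf_class N (Suc m) p"
  unfolding pf_incl_eq by (rule pf_induced_class) (rule pf_class_eq_Suc)

definition shift :: "free_elem \<Rightarrow> free_elem"
  where "shift = word_extend (\<lambda>u. wterm (map Suc u))"

lemma shift_wterm: "shift (wterm u a) = wterm (map Suc u) a"
  unfolding shift_def by (subst word_extend_wterm) (simp_all add: single_add)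

lemma shift_add: "shift (p + r) = shift p + shift r"
  unfolding shift_def by (subst word_extend_add) (simp_all add: single_add)

lemma shift_const: "shift (free_const a) = free_const a"
  by (simp add: free_const_eq shift_wterm)

lemma shift_mult: "shift (p * r) = shift p * shift r"
proof (induct p rule: free_elem_induct)
  case (word u a)
  show ?case
    by (induct r rule: free_elem_induct) (simp_all add: wterm_mult shift_wterm shift_add distrib_left)
qed (simp add: distrib_right shift_add)

lemma shift_closed: "p \<in> carrier (free_alg m) \<Longrightarrow> shift p \<in> carrier (free_alg (Suc m))"
  by (induct p rule: free_alg_induct)
    (force simp: shift_wterm intro!: wterm_closed, simp add: shift_add free_alg_closed_add)

lemma count_list_map_Suc: "count_list (map Suc u) i = (case i of 0 \<Rightarrow> 0 | Suc j \<Rightarrow> count_list u j)"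
  by (induct u) (auto split: nat.splits)

lemma word_cong_map_Suc: "map Suc u \<approx>\<^sub>N map Suc v \<longleftrightarrow> u \<approx>\<^sub>N v"
  unfolding word_cong_def count_list_map_Suc by (auto split: nat.splits)

lemma phase_map_Suc: "phase (map Suc u) = phase u"
  by (simp add: phase_def)

lemma coef_shift: "coef (map Suc u) (shift p) = coef u p"
  by (induct p rule: free_elem_induct)
    (simp_all add: shift_wterm shift_add coef_add coef_wterm word_cong_map_Suc phase_map_Suc)

text \<open>The words \<open>u\<close> in question are those whose number of letters \<open>0\<close> is not divisible by \<open>N\<close>; shifted
  words do not contain this letter.\<close>

lemma coef_shift_eq_0: "(\<And>v. \<not> map Suc v \<approx>\<^sub>N u) \<Longrightarrow> coef u (shift p) = 0"
  by (induct p rule: free_elem_induct) (simp_all add: shift_wterm shift_add coef_add coef_wterm)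

lemma pf_class_eq_shift:
  assumes "p \<in> carrier (free_alg m)" "r \<in> carrier (free_alg m)" "pf_class N m p = pf_class N m r"
  shows "pf_class N (Suc m) (shift p) = pf_class N (Suc m) (shift r)"
proof -
  have "coef u (shift p) = coef u (shift r)" for u
  proof (cases "\<exists>v. map Suc v \<approx>\<^sub>N u")
    case True
    then obtain v where "u \<approx>\<^sub>N map Suc v" using word_cong_sym by blast
    then show ?thesis
      using coef_eq_if_pf_class_eq[OF assms] by (simp add: coef_cong[of u] coef_shift)
  qed (simp add: coef_shift_eq_0)
  then show ?thesis using assms by (simp add: pf_class_eq_iff shift_closed)
qed

lemma pf_iota_l_class:
  assumes "p \<in> carrier (free_alg m)"
  shows "pf_iota_l N m (pf_class N m p) = pf_class N (Suc m) (shift p)"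
proof -
  let ?h = "pf_induced N m (\<lambda>p. pf_class N (Suc m) (shift p))"
  have h: "pf_alg_hom N m (Suc m) ?h"
    by (rule pf_alg_hom_induced)
      (rule shift_add shift_mult shift_const | erule shift_closed | erule (2) pf_class_eq_shift)+
  have hc: "?h (pf_class N m p) = pf_class N (Suc m) (shift p)" if "p \<in> carrier (free_alg m)" for p
    using pf_class_eq_shift that by (rule pf_induced_class)
  have gen: "?h (pf_gen N m i) = pf_gen N (Suc m) (Suc i)" if "i \<in> {1..m}" for i
    using hc[OF free_gen_closed[OF that]] by (simp add: pf_gen_def free_gen_def shift_wterm)
  have "pf_iota_l N m = ?h"
    unfolding pf_iota_l_def
  proof (rule the_equality)
    fix h'
    assume h': "h' \<in> extensional (carrier (PF N m)) \<and> pf_alg_hom N m (m + 1) h' \<and>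
      (\<forall>i\<in>{1..m}. h' (pf_gen N m i) = pf_gen N (m + 1) (i + 1))"
    show "h' = ?h"
      by (rule extensionalityI[of _ "carrier (PF N m)"], use h' in simp, rule pf_induced_extensional)
        (rule pf_alg_hom_unique[of m "Suc m"], use h' h gen in simp_all)
  qed (use h gen in \<open>simp add: pf_induced_extensional\<close>)
  then show ?thesis using hc[OF assms] by simp
qed

section \<open>The conditional expectation\<close>

lemma count_list_filter: "count_list (filter P u) i = (if P i then count_list u i else 0)"
  by (induct u) auto

text \<open>If the last generator occurs a multiple of \<open>N\<close> times it can be erased, so the word comes from the
  smaller algebra; otherwise the expectation kills it (\<open>normal_form_wterm_eq_0\<close>). This dichotomy
  is the whole computation of the conditional expectation.\<close>

lemma word_cong_filter_last:
  assumes "set u \<subseteq> {1..Suc m}" "N dvd count_list u (Suc m)"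
  shows "u \<approx>\<^sub>N filter (\<lambda>i. i \<le> m) u"
  unfolding word_cong_def
proof
  fix i
  have "i \<notin> set u" if "Suc m < i" using assms(1) that by auto
  then show "[count_list u i = count_list (filter (\<lambda>i. i \<le> m) u) i] (mod N)"
    using assms(2) by (cases i "Suc m" rule: linorder_cases) (auto simp: count_list_filter cong_0_iff)
qed

lemma normal_form_wterm_eq_0:
  assumes "\<not> N dvd count_list u (Suc m)"
  shows "normal_form m (wterm u a) = 0"
proof -
  have "\<not> u \<approx>\<^sub>N sorted_word m e" for e
    using assms by (auto simp: word_cong_def count_sorted_word cong_0_iff intro!: exI[of _ "Suc m"])
  then show ?thesis by (simp add: normal_form_def coef_wterm)
qed

text \<open>Factors from the smaller algebra do not change the number of occurrences of the last letter.\<close>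

lemma normal_form_bimodule_eq_0:
  assumes "p \<in> carrier (free_alg m)" "r \<in> carrier (free_alg m)" "\<not> N dvd count_list u (Suc m)"
  shows "normal_form m (p * wterm u a * r) = 0"
  using assms(1)
proof (induct p rule: free_alg_induct)
  case (word v b)
  show ?case
    using assms(2)
  proof (induct r rule: free_alg_induct)
    case (word w c)
    have "Suc m \<notin> set v" "Suc m \<notin> set w" using word \<open>set v \<subseteq> {1..m}\<close> by auto
    then show ?case
      using assms(3) by (simp add: wterm_mult normal_form_wterm_eq_0)
  qed (simp add: distrib_left normal_form_add)
qed (simp add: distrib_right normal_form_add)

lemma normal_form_bimodule:
  assumes p: "p \<in> carrier (free_alg m)" and r: "r \<in> carrier (free_alg m)" and x: "x \<in> carrier (free_alg (Suc m))"
  shows "pf_class N m (normal_form m (p * x * r)) = pf_class N m (p * normal_form m x * r)"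
  using x
proof (induct x rule: free_alg_induct)
  case (word u a)
  show ?case
  proof (cases "N dvd count_list u (Suc m)")
    case True
    define v where "v = filter (\<lambda>i. i \<le> m) u"
    define y where "y = wterm v (a * (phase v / phase u))"
    have v: "u \<approx>\<^sub>N v" "set v \<subseteq> {1..m}"
      using word_cong_filter_last[OF word True] word by (auto simp: v_def)
    then have y: "y \<in> carrier (free_alg m)" by (simp add: y_def wterm_closed)
    have xy: "pf_class N (Suc m) (wterm u a) = pf_class N (Suc m) y"
      unfolding y_def by (rule pf_class_wterm_cong[OF v(1) word]) (use v(2) in auto)
    have "pf_class N (Suc m) (p * wterm u a * r) = pf_class N (Suc m) (p * y * r)"
      using xy p r y word
      by (simp add: pf_class_mult free_alg_mono free_alg_closed_mult wterm_closed)
    then have "normal_form m (p * wterm u a * r) = normal_form m (p * y * r)"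
      using p r y word
      by (intro normal_form_eq_if_pf_class_eq[of _ "Suc m"])
        (simp_all add: free_alg_mono free_alg_closed_mult wterm_closed)
    moreover have "normal_form m (wterm u a) = normal_form m y"
      using xy y word
      by (intro normal_form_eq_if_pf_class_eq[of _ "Suc m"]) (simp_all add: free_alg_mono wterm_closed)
    ultimately show ?thesis
      using p r y
      by (simp add: pf_class_normal_form free_alg_closed_mult pf_class_mult normal_form_closed)
  next
    case False
    then show ?thesis
      using p r by (simp add: normal_form_bimodule_eq_0 normal_form_wterm_eq_0)
  qed
next
  case (add x y)
  then show ?case
    using p r
    by (simp add: distrib_left distrib_right normal_form_add pf_class_add normal_form_closed free_alg_closed_mult)
qed

lemma normal_form_const_mult: "normal_form m (free_const a * p) = free_const a * normal_form m p"
  by (simp add: normal_form_def coef_const_mult sum_distrib_left free_const_mult_wterm)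

definition expectation :: "nat \<Rightarrow> free_elem set \<Rightarrow> free_elem set"
  where "expectation m = pf_induced N (Suc m) (\<lambda>p. pf_class N m (normal_form m p))"

lemma expectation_class:
  "p \<in> carrier (free_alg (Suc m)) \<Longrightarrow> expectation m (pf_class N (Suc m) p) = pf_class N m (normal_form m p)"
  unfolding expectation_def
  by (rule pf_induced_class) (rule arg_cong[OF normal_form_eq_if_pf_class_eq])

lemma expectation_cond_exp: "pf_cond_exp N m (expectation m)"
  unfolding pf_cond_exp_def Suc_eq_plus1[symmetric]
proof (intro conjI ballI allI funcsetI)
  fix x assume "x \<in> carrier (PF N (Suc m))"
  then show "expectation m x \<in> carrier (PF N m)"
    by (auto elim!: PF_cases simp: expectation_class pf_class_closed normal_form_closed)
next
  fix x y assume "x \<in> carrier (PF N (Suc m))" "y \<in> carrier (PF N (Suc m))"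
  then show "expectation m (x \<oplus>\<^bsub>PF N (Suc m)\<^esub> y) = expectation m x \<oplus>\<^bsub>PF N m\<^esub> expectation m y"
    by (auto elim!: PF_cases simp: expectation_class normal_form_add free_alg_closed_add normal_form_closed
        simp flip: pf_class_add)
next
  fix a x assume "x \<in> carrier (PF N (Suc m))"
  then show "expectation m (pf_smult N (Suc m) a x) = pf_smult N m a (expectation m x)"
    by (auto elim!: PF_cases simp: expectation_class pf_smult_class normal_form_const_mult normal_form_closed
        free_alg_closed_mult free_const_closed)
next
  fix a assume "a \<in> carrier (PF N m)"
  then show "expectation m (pf_incl N m a) = a"
    by (auto elim!: PF_cases simp: expectation_class pf_incl_class pf_class_normal_form free_alg_mono)
next
  fix a b x assume "a \<in> carrier (PF N m)" "b \<in> carrier (PF N m)" "x \<in> carrier (PF N (Suc m))"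
  then obtain p r y where p: "p \<in> carrier (free_alg m)" "r \<in> carrier (free_alg m)" "y \<in> carrier (free_alg (Suc m))"
    and x: "a = pf_class N m p" "b = pf_class N m r" "x = pf_class N (Suc m) y"
    by (auto elim!: PF_cases)
  show "expectation m (pf_incl N m a \<otimes>\<^bsub>PF N (Suc m)\<^esub> x \<otimes>\<^bsub>PF N (Suc m)\<^esub> pf_incl N m b)
      = a \<otimes>\<^bsub>PF N m\<^esub> expectation m x \<otimes>\<^bsub>PF N m\<^esub> b"
    using normal_form_bimodule[OF p] p unfolding x
    by (simp add: pf_incl_class expectation_class free_alg_mono free_alg_closed_mult normal_form_closed
        flip: pf_class_mult)
next
  fix x assume "x \<in> carrier (PF N (Suc m))"
  then show "pf_tr N m (expectation m x) = pf_tr N (Suc m) x"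
    by (auto elim!: PF_cases simp: pf_tr_eq expectation_class trace_class normal_form_closed coef_normal_form)
qed

text \<open>The bimodule property and the preservation of the trace determine all pairings of the value with
  the smaller algebra, whatever the conditional expectation is.\<close>

lemma cond_exp_trace:
  assumes "pf_cond_exp N m \<Phi>" "x \<in> carrier (PF N (Suc m))" "b \<in> carrier (PF N m)"
  shows "trace m (b \<otimes>\<^bsub>PF N m\<^esub> \<Phi> x) = trace (Suc m) (pf_incl N m b \<otimes>\<^bsub>PF N (Suc m)\<^esub> x)"
proof -
  interpret A: ring "PF N m" by (rule ring_PF)
  interpret B: ring "PF N (Suc m)" by (rule ring_PF)
  have one: "pf_incl N m \<one>\<^bsub>PF N m\<^esub> = \<one>\<^bsub>PF N (Suc m)\<^esub>"
    using pf_incl_class[OF free_alg_closed_one, of m] by (simp add: pf_class_one)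
  have "pf_incl N m b \<in> carrier (PF N (Suc m))"
    using assms(3) by (auto elim!: PF_cases simp: pf_incl_class pf_class_closed free_alg_mono)
  then have incl: "pf_incl N m b \<otimes>\<^bsub>PF N (Suc m)\<^esub> x \<in> carrier (PF N (Suc m))"
    using assms(2) by simp
  \<comment> \<open>A left module property is obtained from the bimodule property with 1 on the right.\<close>
  have "\<Phi> (pf_incl N m b \<otimes>\<^bsub>PF N (Suc m)\<^esub> x \<otimes>\<^bsub>PF N (Suc m)\<^esub> pf_incl N m \<one>\<^bsub>PF N m\<^esub>)
      = b \<otimes>\<^bsub>PF N m\<^esub> \<Phi> x \<otimes>\<^bsub>PF N m\<^esub> \<one>\<^bsub>PF N m\<^esub>"
    using assms A.one_closed unfolding pf_cond_exp_def Suc_eq_plus1[symmetric] by blast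
  moreover have "\<Phi> x \<in> carrier (PF N m)"
    using assms(1,2) unfolding pf_cond_exp_def Suc_eq_plus1[symmetric]
    by (elim conjE) (rule funcset_mem)
  ultimately have "\<Phi> (pf_incl N m b \<otimes>\<^bsub>PF N (Suc m)\<^esub> x) = b \<otimes>\<^bsub>PF N m\<^esub> \<Phi> x"
    using incl assms(3) by (simp add: one)
  moreover have "\<forall>x\<in>carrier (PF N (Suc m)). trace m (\<Phi> x) = trace (Suc m) x"
    using assms(1) unfolding pf_cond_exp_def Suc_eq_plus1[symmetric] pf_tr_eq by (elim conjE)
  ultimately show ?thesis using incl by metis
qed

lemma pf_Phi_r_eq: "pf_Phi_r N m = expectation m"
  unfolding pf_Phi_r_def
proof (rule the_equality)
  fix \<Phi> assume \<Phi>: "\<Phi> \<in> extensional (carrier (PF N (m + 1))) \<and> pf_cond_exp N m \<Phi>"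
  show "\<Phi> = expectation m"
  proof (rule extensionalityI)
    fix x assume x: "x \<in> carrier (PF N (Suc m))"
    show "\<Phi> x = expectation m x"
    proof (rule trace_nondegenerate)
      show "\<Phi> x \<in> carrier (PF N m)" "expectation m x \<in> carrier (PF N m)"
        using \<Phi> expectation_cond_exp[of m] x unfolding pf_cond_exp_def by auto
    qed (use cond_exp_trace x \<Phi> expectation_cond_exp in simp)
  qed (use \<Phi> in \<open>simp_all add: expectation_def pf_induced_extensional\<close>)
qed (simp add: expectation_cond_exp, simp add: expectation_def pf_induced_extensional)

lemma pf_Phi_r_class:
  "p \<in> carrier (free_alg (Suc m)) \<Longrightarrow> pf_Phi_r N m (pf_class N (Suc m) p) = pf_class N m (normal_form m p)"
  by (simp add: pf_Phi_r_eq expectation_class)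

end

section \<open>Integer powers of the generators\<close>

lemma inversions_replicate [simp]: "inversions (replicate n x) = 0"
  by (simp add: inversions_sorted)

lemma list_in_range: "set ys \<subseteq> range f \<Longrightarrow> \<exists>xs. ys = map f xs"
  unfolding ex_map_conv by blast

context parafermions
begin

text \<open>Since \<open>c\<^sub>i\<^sup>N = 1\<close>, an integer power equals the power with this nonnegative exponent.\<close>

definition residue :: "int \<Rightarrow> nat"
  where "residue z = nat (z mod int N)"

lemma int_residue: "int (residue z) = z mod int N"
  using N_pos by (simp add: residue_def)

lemma residue_cong_self: "[int (residue z) = z] (mod int N)"
  by (simp add: int_residue cong_def)

lemma residue_less: "residue z < N"
  using N_pos by (simp add: residue_def nat_less_iff)

lemma residue_of_nat: "residue (int k) = k mod N"
  by (simp add: residue_def flip: zmod_int)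

lemma residue_cong: "[i = j] (mod int N) \<Longrightarrow> residue i = residue j"
  by (simp add: residue_def cong_def)

lemma replicate_word_cong: "[a = b] (mod N) \<Longrightarrow> replicate a i \<approx>\<^sub>N replicate b i"
  by (simp add: word_cong_def)

lemma phase_replicate [simp]: "phase (replicate n i) = 1"
  by (simp add: phase_def)

lemma pf_gen_int_pow:
  assumes "i \<in> {1..m}"
  shows "pf_gen N m i [^]\<^bsub>PF N m\<^esub> (z::int) = pf_class N m (wterm (replicate (residue z) i) 1)"
proof -
  interpret ring "PF N m" by (rule ring_PF)
  have sets: "set (replicate n i) \<subseteq> {1..m}" for n
    using assms by (simp add: set_replicate_conv_if)
  have eq: "pf_class N m (wterm (replicate a i) 1) = pf_class N m (wterm (replicate b i) 1)"
    if "[a = b] (mod N)" for a b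
    using pf_class_wterm_cong[OF replicate_word_cong[OF that] sets sets, of 1] by simp
  show ?thesis
  proof (cases "z < 0")
    case False
    then have "[nat z = residue z] (mod N)"
      by (simp add: cong_int_iff[symmetric] int_residue cong_def)
    then show ?thesis
      using False eq by (simp add: int_pow_def2 pf_gen_nat_pow[OF assms])
  next
    case True
    let ?x = "pf_class N m (wterm (replicate (nat (- z)) i) 1)"
    let ?y = "pf_class N m (wterm (replicate (residue z) i) 1)"
    have x: "?x \<in> carrier (PF N m)" and y: "?y \<in> carrier (PF N m)"
      by (intro pf_class_closed wterm_closed sets)+
    have "[nat (- z) + residue z = 0] (mod N)" "[residue z + nat (- z) = 0] (mod N)"
      using True by (simp_all add: cong_int_iff[symmetric] int_residue cong_def mod_simps)
    then have xy: "?x \<otimes>\<^bsub>PF N m\<^esub> ?y = \<one>\<^bsub>PF N m\<^esub>" "?y \<otimes>\<^bsub>PF N m\<^esub> ?x = \<one>\<^bsub>PF N m\<^esub>"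
      using eq[of "nat (- z) + residue z" 0] eq[of "residue z + nat (- z)" 0]
      by (simp_all add: pf_class_wterm_mult[OF sets sets] replicate_add free_one_eq flip: pf_class_one)
    then have "?x \<in> Units (PF N m)" using x y unfolding Units_def by blast
    then have "inv\<^bsub>PF N m\<^esub> ?x = ?y"
      using inv_unique[OF Units_l_inv xy(1) x] y by simp
    then show ?thesis
      using True by (simp add: int_pow_def2 pf_gen_nat_pow[OF assms])
  qed
qed

lemma q_powi_cong:
  assumes "[a = b] (mod int N)"
  shows "q powi a = q powi b"
proof -
  have "int N dvd a - b" using assms by (simp add: cong_iff_dvd_diff)
  then obtain t where "a - b = int N * t" by (rule dvdE)
  then have "a = b + int N * t" by simp
  then have "q powi a = q powi b * (q powi int N) powi t"
    by (simp add: power_int_add power_int_mult)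
  then show ?thesis by (simp add: q_power_N)
qed

definition g_word :: "int \<Rightarrow> nat list"
  where "g_word i = replicate (residue i) 1 @ replicate (residue (- i)) 2"

lemma set_g_word: "set (g_word i) \<subseteq> {1..2}"
  by (auto simp: g_word_def)

lemma phase_g_word [simp]: "phase (g_word i) = 1"
  by (simp add: phase_def g_word_def)

lemma g_word_cong: "[i = j] (mod int N) \<Longrightarrow> g_word i = g_word j"
  using residue_cong[of i j] residue_cong[of "- i" "- j"] by (simp add: g_word_def cong_minus_minus_iff)

lemma g_word_inj:
  assumes "j < N" "k < N" "g_word (int j) \<approx>\<^sub>N g_word (int k)"
  shows "j = k"
  using assms by (auto simp: word_cong_def g_word_def residue_of_nat cong_def dest!: spec[of _ 1])

end

section \<open>The elements of degree zero in the 2-box space\<close>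

locale parafermions_root = parafermions +
  fixes \<zeta> :: complex
  assumes \<zeta>_square: "\<zeta>\<^sup>2 = q" and \<zeta>_power: "\<zeta> ^ (N\<^sup>2) = 1"
begin

lemma \<zeta>_nonzero [simp]: "\<zeta> \<noteq> 0"
  using \<zeta>_square q_nonzero by auto

lemma \<zeta>_powi_double: "\<zeta> powi (2 * n) = q powi n"
  using power_int_mult[of \<zeta> 2 n] \<zeta>_square by simp

text \<open>Writing \<open>i = j + N t\<close>, the exponent changes by \<open>2 N j t + N\<^sup>2 t\<^sup>2\<close>; the first part vanishes since
  \<open>\<zeta>\<^sup>2\<^sup>N = q\<^sup>N = 1\<close> and the second since \<open>\<zeta>\<close> to the power \<open>N\<^sup>2\<close> is 1. This is where the choice of the
  square root matters for odd \<open>N\<close>.\<close>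

lemma \<zeta>_powi_square_cong:
  assumes "[i = j] (mod int N)"
  shows "\<zeta> powi (i\<^sup>2) = \<zeta> powi (j\<^sup>2)"
proof -
  have "int N dvd i - j" using assms by (simp add: cong_iff_dvd_diff)
  then obtain t where "i - j = int N * t" by (rule dvdE)
  then have t: "i = j + int N * t" by simp
  have "i\<^sup>2 = j\<^sup>2 + 2 * (int N * (j * t)) + int (N\<^sup>2) * t\<^sup>2"
    by (simp add: t power2_eq_square algebra_simps)
  then have "\<zeta> powi (i\<^sup>2) = \<zeta> powi (j\<^sup>2) * q powi (int N * (j * t)) * (\<zeta> powi int (N\<^sup>2)) powi t\<^sup>2"
    by (simp only: power_int_add[OF disjI1[OF \<zeta>_nonzero]] \<zeta>_powi_double power_int_mult[of \<zeta> "int (N\<^sup>2)"])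
  also have "q powi (int N * (j * t)) = 1"
    using q_powi_cong[of "int N * (j * t)" 0] by (simp add: cong_def)
  also have "\<zeta> powi int (N\<^sup>2) = 1"
    unfolding power_int_of_nat by (rule \<zeta>_power)
  finally show ?thesis by simp
qed

abbreviation g_term :: "int \<Rightarrow> free_elem"
  where "g_term i \<equiv> wterm (g_word i) (\<zeta> powi (i\<^sup>2))"

lemma pf_g_eq: "pf_g N \<zeta> i = pf_class N 2 (g_term i)"
  unfolding pf_g_def
  by (subst (1 2) pf_gen_int_pow)
    (simp_all add: pf_class_wterm_mult pf_smult_wterm set_replicate_conv_if g_word_def)

lemma g_term_closed: "g_term i \<in> carrier (free_alg 2)"
  by (rule wterm_closed[OF set_g_word])

lemma pf_g_cong:
  assumes "[i = j] (mod int N)"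
  shows "pf_g N \<zeta> i = pf_g N \<zeta> j"
  by (simp only: pf_g_eq g_word_cong[OF assms] \<zeta>_powi_square_cong[OF assms])

section \<open>The basis of the zero-graded part\<close>

lemma pf_const_hom:
  "pf_const N m (a * b) = pf_const N m a \<otimes>\<^bsub>PF N m\<^esub> pf_const N m b"
  "pf_const N m (a + b) = pf_const N m a \<oplus>\<^bsub>PF N m\<^esub> pf_const N m b"
  "pf_const N m 1 = \<one>\<^bsub>PF N m\<^esub>" "pf_const N m 0 = \<zero>\<^bsub>PF N m\<^esub>"
proof -
  have "free_const (a * b) = free_const a * free_const b"
    by (simp add: free_const_eq wterm_mult)
  then show "pf_const N m (a * b) = pf_const N m a \<otimes>\<^bsub>PF N m\<^esub> pf_const N m b"
    by (simp only: pf_const_def pf_class_mult[OF free_const_closed free_const_closed])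
  have "free_const (a + b) = free_const a + free_const b"
    by (simp add: free_const_eq single_add)
  then show "pf_const N m (a + b) = pf_const N m a \<oplus>\<^bsub>PF N m\<^esub> pf_const N m b"
    by (simp only: pf_const_def pf_class_add[OF free_const_closed free_const_closed])
  show "pf_const N m 1 = \<one>\<^bsub>PF N m\<^esub>" "pf_const N m 0 = \<zero>\<^bsub>PF N m\<^esub>"
    by (simp_all add: pf_const_def free_const_def pf_class_one pf_class_zero)
qed

lemma pf_const_eq_0_iff: "pf_const N m a = \<zero>\<^bsub>PF N m\<^esub> \<longleftrightarrow> a = 0"
proof
  assume "pf_const N m a = \<zero>\<^bsub>PF N m\<^esub>"
  then have "pf_class N m (free_const a) = pf_class N m 0"
    by (simp only: pf_const_def pf_class_zero)
  then have "coef [] (free_const a) = coef [] 0"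
    by (rule coef_eq_if_pf_class_eq[OF free_const_closed free_alg_closed_zero])
  then show "a = 0" by (simp add: free_const_eq coef_wterm)
qed (simp add: pf_const_hom)

text \<open>Needed because spans and independence are taken over this copy of the complex numbers.\<close>

lemma subfield_pf_const: "subfield (range (pf_const N m)) (PF N m)"
proof -
  interpret ring "PF N m" by (rule ring_PF)
  let ?c = "pf_const N m"
  have closed: "?c a \<in> carrier (PF N m)" for a
    by (simp add: pf_const_def pf_class_closed free_const_closed)
  have "subring (range ?c) (PF N m)"
  proof (rule subringI)
    show "range ?c \<subseteq> carrier (PF N m)" using closed by (rule image_subsetI)
    show "\<one>\<^bsub>PF N m\<^esub> \<in> range ?c" by (rule range_eqI[of _ _ 1]) (rule pf_const_hom(3)[symmetric])
  next
    fix h assume "h \<in> range ?c"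
    then obtain a where h: "h = ?c a" by (rule rangeE)
    have "?c (- a) \<oplus>\<^bsub>PF N m\<^esub> ?c a = \<zero>\<^bsub>PF N m\<^esub>"
      unfolding pf_const_hom(2)[symmetric] left_minus by (rule pf_const_hom(4))
    then have "\<ominus>\<^bsub>PF N m\<^esub> h = ?c (- a)"
      unfolding h by (rule minus_equality[OF _ closed closed])
    then show "\<ominus>\<^bsub>PF N m\<^esub> h \<in> range ?c" by (rule range_eqI)
  next
    fix h k assume "h \<in> range ?c" "k \<in> range ?c"
    then obtain a b where hk: "h = ?c a" "k = ?c b" by (elim rangeE)
    show "h \<otimes>\<^bsub>PF N m\<^esub> k \<in> range ?c" unfolding hk pf_const_hom(1)[symmetric] by (rule rangeI)
    show "h \<oplus>\<^bsub>PF N m\<^esub> k \<in> range ?c" unfolding hk pf_const_hom(2)[symmetric] by (rule rangeI)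
  qed
  then have subcring: "subcring (range ?c) (PF N m)"
  proof (rule subcringI)
    fix h k assume "h \<in> range ?c" "k \<in> range ?c"
    then obtain a b where hk: "h = ?c a" "k = ?c b" by (elim rangeE)
    show "h \<otimes>\<^bsub>PF N m\<^esub> k = k \<otimes>\<^bsub>PF N m\<^esub> h"
      unfolding hk pf_const_hom(1)[symmetric] by (simp only: mult.commute)
  qed
  show ?thesis
  proof (rule subfieldI[OF subcring])
    let ?K = "PF N m\<lparr>carrier := range ?c\<rparr>"
    have ne: "\<one>\<^bsub>PF N m\<^esub> \<noteq> \<zero>\<^bsub>PF N m\<^esub>"
      using pf_const_eq_0_iff[of m 1] by (simp add: pf_const_hom(3))
    show "Units ?K = range ?c - {\<zero>\<^bsub>PF N m\<^esub>}"
    proof (intro equalityI subsetI)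
      fix x assume "x \<in> Units ?K"
      then have "x \<in> carrier ?K \<and> (\<exists>y\<in>carrier ?K. y \<otimes>\<^bsub>?K\<^esub> x = \<one>\<^bsub>?K\<^esub> \<and> x \<otimes>\<^bsub>?K\<^esub> y = \<one>\<^bsub>?K\<^esub>)"
        unfolding Units_def by (rule CollectD)
      then obtain y where "x \<in> carrier ?K" "y \<in> carrier ?K" "y \<otimes>\<^bsub>?K\<^esub> x = \<one>\<^bsub>?K\<^esub>"
        by (elim conjE bexE)
      then have x: "x \<in> range ?c" and y: "y \<in> range ?c" and yx: "y \<otimes>\<^bsub>PF N m\<^esub> x = \<one>\<^bsub>PF N m\<^esub>"
        by simp_all
      obtain b where "y = ?c b" using y by (rule rangeE)
      then have "y \<in> carrier (PF N m)" by (simp only: closed)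
      then have "x \<noteq> \<zero>\<^bsub>PF N m\<^esub>" using yx[symmetric] ne by (intro notI) simp
      with x show "x \<in> range ?c - {\<zero>\<^bsub>PF N m\<^esub>}" by simp
    next
      fix x assume "x \<in> range ?c - {\<zero>\<^bsub>PF N m\<^esub>}"
      then have "x \<in> range ?c" and x0: "x \<noteq> \<zero>\<^bsub>PF N m\<^esub>" by simp_all
      then obtain a where x: "x = ?c a" by (elim rangeE)
      have a: "a \<noteq> 0" using x0 unfolding x pf_const_eq_0_iff .
      have inv: "?c (inverse a) \<otimes>\<^bsub>PF N m\<^esub> x = \<one>\<^bsub>PF N m\<^esub>" "x \<otimes>\<^bsub>PF N m\<^esub> ?c (inverse a) = \<one>\<^bsub>PF N m\<^esub>"
        unfolding x pf_const_hom(1)[symmetric] left_inverse[OF a] right_inverse[OF a]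
        by (rule pf_const_hom(3))+
      have "x \<in> carrier ?K \<and> (\<exists>y\<in>carrier ?K. y \<otimes>\<^bsub>?K\<^esub> x = \<one>\<^bsub>?K\<^esub> \<and> x \<otimes>\<^bsub>?K\<^esub> y = \<one>\<^bsub>?K\<^esub>)"
        using inv unfolding x by (intro conjI bexI[of _ "?c (inverse a)"]) simp_all
      then show "x \<in> Units ?K"
        unfolding Units_def by (rule CollectI)
    qed
  qed
qed

lemma pf_combine:
  assumes "set ps \<subseteq> carrier (free_alg m)"
  shows "ring.combine (PF N m) (map (pf_const N m) as) (map (pf_class N m) ps) =
    pf_class N m (\<Sum>k<min (length as) (length ps). free_const (as ! k) * ps ! k)"
proof -
  interpret ring "PF N m" by (rule ring_PF)
  have nth: "k < length rs \<Longrightarrow> set rs \<subseteq> carrier (free_alg m) \<Longrightarrow> rs ! k \<in> carrier (free_alg m)" for rs k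
    using nth_mem by blast
  show ?thesis
    using assms
  proof (induct as ps rule: list_induct2')
    case (4 a as p ps)
    have "(\<Sum>k<min (length as) (length ps). free_const (as ! k) * ps ! k) \<in> carrier (free_alg m)"
      using 4 by (intro free_alg_closed_sum free_alg_closed_mult free_const_closed nth) auto
    with 4 show ?case
      by (simp add: sum.lessThan_Suc_shift pf_class_add pf_class_mult free_alg_closed_mult free_const_closed
          del: sum.lessThan_Suc flip: pf_const_def)
  qed (simp_all add: pf_class_zero)
qed

lemma g_list_eq: "map (\<lambda>i. pf_g N \<zeta> (int i)) [0..<N] = map (pf_class N 2) (map (\<lambda>i. g_term (int i)) [0..<N])"
  by (simp add: pf_g_eq)

text \<open>The words of distinct \<open>g\<^sub>j\<close> are not congruent, so each coefficient sees one of them only.\<close>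

lemma coef_g_sum:
  assumes "k < N" "n \<le> N"
  shows "coef (g_word (int k)) (\<Sum>j<n. free_const (a j) * g_term (int j)) =
    (if k < n then a k * \<zeta> powi ((int k)\<^sup>2) else 0)"
proof -
  have "coef (g_word (int k)) (\<Sum>j<n. free_const (a j) * g_term (int j)) =
      (\<Sum>j<n. if j = k then a j * \<zeta> powi ((int j)\<^sup>2) else 0)"
    unfolding coef_sum
  proof (rule sum.cong[OF refl])
    fix j assume "j \<in> {..<n}"
    then show "coef (g_word (int k)) (free_const (a j) * g_term (int j)) =
        (if j = k then a j * \<zeta> powi ((int j)\<^sup>2) else 0)"
      using assms g_word_inj[of j k] by (auto simp: coef_const_mult coef_wterm)
  qed
  then show ?thesis by simp
qed

lemma independent_g:
  "ring.independent (PF N 2) (range (pf_const N 2)) (map (\<lambda>i. pf_g N \<zeta> (int i)) [0..<N])"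
proof -
  interpret ring "PF N 2" by (rule ring_PF)
  let ?ps = "map (\<lambda>i. g_term (int i)) [0..<N]"
  have ps: "set ?ps \<subseteq> carrier (free_alg 2)" using g_term_closed by auto
  show ?thesis
    unfolding g_list_eq
  proof (rule trivial_combine_imp_independent[OF subfield_pf_const])
    show "set (map (pf_class N 2) ?ps) \<subseteq> carrier (PF N 2)"
      using g_term_closed by (auto simp: pf_class_closed)
    fix Ks assume "set Ks \<subseteq> range (pf_const N 2)"
    from list_in_range[OF this] obtain as where as: "Ks = map (pf_const N 2) as" ..
    assume zero: "combine Ks (map (pf_class N 2) ?ps) = \<zero>\<^bsub>PF N 2\<^esub>"
    define n where "n = min (length as) N"
    have sum: "(\<Sum>k<min (length as) (length ?ps). free_const (as ! k) * ?ps ! k) = (\<Sum>k<n. free_const (as ! k) * g_term (int k))"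
      unfolding n_def by (rule sum.cong) auto
    have z: "pf_class N 2 (\<Sum>k<n. free_const (as ! k) * g_term (int k)) = pf_class N 2 0"
      using zero unfolding as pf_combine[OF ps] sum by (simp add: pf_class_zero)
    have "coef u (\<Sum>k<n. free_const (as ! k) * g_term (int k)) = coef u 0" for u
      by (rule coef_eq_if_pf_class_eq[OF _ _ z])
        (intro free_alg_closed_sum free_alg_closed_mult free_const_closed g_term_closed free_alg_closed_zero)+
    then have "as ! k = 0" if "k < n" for k
      using coef_g_sum[of k n "\<lambda>k. as ! k"] that by (simp add: n_def)
    then have nth: "pf_const N 2 (as ! k) = \<zero>\<^bsub>PF N 2\<^esub>" if "k < n" for k
      using that by (simp add: pf_const_hom)
    have take: "take (length (map (pf_class N 2) ?ps)) Ks = map (\<lambda>k. pf_const N 2 (as ! k)) [0..<n]"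
      unfolding as by (rule nth_equalityI) (simp_all add: n_def min.commute)
    show "set (take (length (map (pf_class N 2) ?ps)) Ks) \<subseteq> {\<zero>\<^bsub>PF N 2\<^esub>}"
      unfolding take using nth by auto
  qed
qed

text \<open>The exponents of the basis monomial proportional to \<open>g\<^sub>k\<close>; they are the exponent pairs with sum
  divisible by \<open>N\<close>.\<close>

definition g_exponents :: "nat \<Rightarrow> nat \<Rightarrow> nat"
  where "g_exponents k = (\<lambda>i\<in>{1..2}. if i = 1 then k else residue (- int k))"

lemma sorted_word_g_exponents:
  "k < N \<Longrightarrow> sorted_word 2 (g_exponents k) = g_word (int k)"
  by (simp add: sorted_word_def g_exponents_def g_word_def residue_of_nat numeral_2_eq_2)

lemma g_exponents_in: "k < N \<Longrightarrow> g_exponents k \<in> pf_exponents N 2"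
  using residue_less by (auto simp: g_exponents_def pf_exponents_def)

lemma g_exponents_degree: "[(\<Sum>i = 1..2. g_exponents k i) = 0] (mod N)"
proof -
  have "[int (k + residue (- int k)) = int 0] (mod int N)"
    by (simp add: int_residue cong_def mod_simps)
  then have "[k + residue (- int k) = 0] (mod N)" by (simp only: cong_int_iff)
  then show ?thesis by (simp add: g_exponents_def numeral_2_eq_2)
qed

lemma g_exponents_unique:
  assumes "e \<in> pf_exponents N 2" "[(\<Sum>i = 1..2. e i) = 0] (mod N)"
  shows "e = g_exponents (e 1)" "e 1 < N"
proof -
  have lt: "e 1 < N" "e 2 < N" and ext: "e \<in> extensional {1..2}"
    using assms(1) by (auto simp: pf_exponents_def PiE_def)
  have "[e 1 + e 2 = 0] (mod N)" using assms(2) by (simp add: numeral_2_eq_2)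
  then have "[int (e 1 + e 2) = int 0] (mod int N)" by (simp only: cong_int_iff)
  then have "[int (e 2) = - int (e 1)] (mod int N)"
    by (simp add: cong_iff_dvd_diff add.commute)
  then have e2: "e 2 = residue (- int (e 1))"
    using residue_cong[of "int (e 2)" "- int (e 1)"] lt by (simp add: residue_of_nat)
  show "e = g_exponents (e 1)"
  proof (rule extensionalityI[OF ext])
    fix i :: nat assume "i \<in> {1..2}"
    then have "i = 1 \<or> i = 2" by auto
    then show "e i = g_exponents (e 1) i" using e2 by (auto simp: g_exponents_def)
  qed (simp add: g_exponents_def)
  show "e 1 < N" by (rule lt)
qed

lemma sum_degree_zero:
  fixes f :: "(nat \<Rightarrow> nat) \<Rightarrow> free_elem"
  assumes "\<And>e. e \<in> pf_exponents N 2 \<Longrightarrow> \<not> [(\<Sum>i = 1..2. e i) = 0] (mod N) \<Longrightarrow> f e = 0"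
  shows "(\<Sum>e\<in>pf_exponents N 2. f e) = (\<Sum>k<N. f (g_exponents k))"
proof -
  have inj: "inj_on g_exponents {..<N}"
    by (rule inj_on_inverseI[where g = "\<lambda>e. e 1"]) (simp add: g_exponents_def)
  have "(\<Sum>e\<in>pf_exponents N 2. f e) = (\<Sum>e\<in>g_exponents ` {..<N}. f e)"
  proof (rule sum.mono_neutral_right[OF finite_pf_exponents])
    show "\<forall>e\<in>pf_exponents N 2 - g_exponents ` {..<N}. f e = 0"
      using assms g_exponents_unique by blast
  qed (use g_exponents_in in auto)
  also have "\<dots> = (\<Sum>k<N. f (g_exponents k))" by (simp add: sum.reindex[OF inj])
  finally show ?thesis .
qed

lemma pf_graded_eq:
  "pf_graded N 2 0 = {pf_class N 2 (\<Sum>k<N. free_const (a k) * g_term (int k)) | a. True}"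
proof -
  let ?P = "\<lambda>a. \<forall>e\<in>pf_exponents N 2. a e \<noteq> 0 \<longrightarrow> [(\<Sum>i = 1..2. e i) = 0] (mod N)"
  have fin: "(\<Oplus>\<^bsub>PF N 2\<^esub>e\<in>pf_exponents N 2. pf_smult N 2 (a e) (pf_monom N 2 e)) =
      pf_class N 2 (\<Sum>k<N. wterm (g_word (int k)) (a (g_exponents k)))" if "?P a" for a
  proof -
    have "(\<Oplus>\<^bsub>PF N 2\<^esub>e\<in>pf_exponents N 2. pf_smult N 2 (a e) (pf_monom N 2 e)) =
        (\<Oplus>\<^bsub>PF N 2\<^esub>e\<in>pf_exponents N 2. pf_class N 2 (wterm (sorted_word 2 e) (a e)))"
      unfolding pf_monom_eq pf_smult_wterm[OF set_sorted_word] by simp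
    also have "\<dots> = pf_class N 2 (\<Sum>e\<in>pf_exponents N 2. wterm (sorted_word 2 e) (a e))"
      by (intro pf_class_finsum finite_pf_exponents wterm_closed set_sorted_word)
    also have "(\<Sum>e\<in>pf_exponents N 2. wterm (sorted_word 2 e) (a e)) =
        (\<Sum>k<N. wterm (sorted_word 2 (g_exponents k)) (a (g_exponents k)))"
      by (rule sum_degree_zero) (metis single_zero that)
    also have "\<dots> = (\<Sum>k<N. wterm (g_word (int k)) (a (g_exponents k)))"
      by (rule sum.cong) (simp_all add: sorted_word_g_exponents)
    finally show ?thesis .
  qed
  show ?thesis
  proof (intro equalityI subsetI)
    fix x assume "x \<in> pf_graded N 2 0"
    then obtain a where a: "?P a"
      and x: "x = (\<Oplus>\<^bsub>PF N 2\<^esub>e\<in>pf_exponents N 2. pf_smult N 2 (a e) (pf_monom N 2 e))"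
      unfolding pf_graded_def by blast
    have "x = pf_class N 2 (\<Sum>k<N. free_const (a (g_exponents k) / \<zeta> powi ((int k)\<^sup>2)) * g_term (int k))"
      unfolding x fin[OF a] by (simp add: free_const_mult_wterm)
    then show "x \<in> {pf_class N 2 (\<Sum>k<N. free_const (a k) * g_term (int k)) | a. True}"
      by (intro CollectI exI[of _ "\<lambda>k. a (g_exponents k) / \<zeta> powi ((int k)\<^sup>2)"]) simp
  next
    fix x assume "x \<in> {pf_class N 2 (\<Sum>k<N. free_const (a k) * g_term (int k)) | a. True}"
    then obtain b where x: "x = pf_class N 2 (\<Sum>k<N. free_const (b k) * g_term (int k))" by blast
    define a where "a e = (if [(\<Sum>i = 1..2. e i) = 0] (mod N) then b (e 1) * \<zeta> powi ((int (e 1))\<^sup>2) else 0)"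
      for e :: "nat \<Rightarrow> nat"
    have P: "?P a" by (simp add: a_def)
    have "a (g_exponents k) = b k * \<zeta> powi ((int k)\<^sup>2)" for k
      unfolding a_def using g_exponents_degree[of k] by (simp add: g_exponents_def)
    then have "x = (\<Oplus>\<^bsub>PF N 2\<^esub>e\<in>pf_exponents N 2. pf_smult N 2 (a e) (pf_monom N 2 e))"
      unfolding fin[OF P] x by (simp add: free_const_mult_wterm)
    with P show "x \<in> pf_graded N 2 0" unfolding pf_graded_def by blast
  qed
qed

lemma Span_g:
  "ring.Span (PF N 2) (range (pf_const N 2)) (map (\<lambda>i. pf_g N \<zeta> (int i)) [0..<N]) = pf_graded N 2 0"
proof -
  interpret ring "PF N 2" by (rule ring_PF)
  let ?ps = "map (\<lambda>i. g_term (int i)) [0..<N]"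
  have ps: "set ?ps \<subseteq> carrier (free_alg 2)" using g_term_closed by auto
  have carrier: "set (map (pf_class N 2) ?ps) \<subseteq> carrier (PF N 2)"
    using g_term_closed by (auto simp: pf_class_closed)
  have comb: "combine (map (pf_const N 2) as) (map (pf_class N 2) ?ps) =
      pf_class N 2 (\<Sum>k<N. free_const (as ! k) * g_term (int k))" if "length as = N" for as
  proof -
    have "(\<Sum>k<min (length as) (length ?ps). free_const (as ! k) * ?ps ! k) = (\<Sum>k<N. free_const (as ! k) * g_term (int k))"
      using that by (intro sum.cong) auto
    then show ?thesis unfolding pf_combine[OF ps] by simp
  qed
  show ?thesis
    unfolding g_list_eq Span_eq_combine_set_length_version[OF subfield_pf_const carrier] pf_graded_eq
  proof (intro equalityI subsetI; elim CollectE exE conjE)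
    fix x Ks assume x: "x = combine Ks (map (pf_class N 2) ?ps)" "length Ks = length (map (pf_class N 2) ?ps)"
      and "set Ks \<subseteq> range (pf_const N 2)"
    from list_in_range[OF this(3)] obtain as where as: "Ks = map (pf_const N 2) as" ..
    have "x = pf_class N 2 (\<Sum>k<N. free_const (as ! k) * g_term (int k))"
      using x comb[of as] unfolding as by simp
    then show "x \<in> {pf_class N 2 (\<Sum>k<N. free_const (a k) * g_term (int k)) | a. True}"
      by (intro CollectI exI[of _ "\<lambda>k. as ! k"]) simp
  next
    fix x a assume x: "x = pf_class N 2 (\<Sum>k<N. free_const (a k) * g_term (int k))"
    let ?Ks = "map (pf_const N 2) (map a [0..<N])"
    have "x = combine ?Ks (map (pf_class N 2) ?ps)"
      unfolding x by (subst comb) (auto intro!: arg_cong[of _ _ "pf_class N 2"] sum.cong)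
    then show "x \<in> {combine Ks (map (pf_class N 2) ?ps) | Ks.
        length Ks = length (map (pf_class N 2) ?ps) \<and> set Ks \<subseteq> range (pf_const N 2)}"
      by (intro CollectI exI[of _ ?Ks]) auto
  qed
qed

end

section \<open>The string Fourier transform\<close>

lemma free_const_left_commute: "r * (free_const a * p) = free_const a * (r * p)"
proof -
  have "r * free_const a = free_const a * r"
    by (induct r rule: free_elem_induct)
      (simp_all add: free_const_eq wterm_mult distrib_left distrib_right mult.commute)
  then show ?thesis by (simp only: mult.assoc[symmetric])
qed

context parafermions
begin

abbreviation E_word :: "nat \<Rightarrow> nat \<Rightarrow> nat list"
  where "E_word i k \<equiv> replicate k i @ replicate (residue (- int k)) (Suc i)"

text \<open>The word of the term \<open>(l, k)\<close> of \<open>E\<^sub>2 E\<^sub>1 \<iota>\<^sub>l(g\<^sub>i)\<close> for the one value of \<open>l\<close> that survives the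
  expectation. The exponents of \<open>c\<^sub>3\<close> cancel, those of \<open>c\<^sub>2\<close> add up to \<open>- i - k + i = - k\<close>, and the
  crossings are \<open>- i k\<close> (first \<open>c\<^sub>2\<close> block with \<open>c\<^sub>1\<close>), \<open>i k\<close> (\<open>c\<^sub>3\<close> with \<open>c\<^sub>1\<close>) and \<open>i (i - k)\<close> (\<open>c\<^sub>3\<close>
  with the later \<open>c\<^sub>2\<close>).\<close>

lemma E2_E1_word:
  fixes i :: int and k :: nat
  defines "l \<equiv> residue (- i)"
  defines "w \<equiv> E_word 2 l @ E_word 1 k @ map Suc (g_word i)"
  shows "w \<approx>\<^sub>N g_word (int k)" and "phase w = q powi (i\<^sup>2 - i * int k)"
proof -
  have cong: "[a = b] (mod N)" if "int a mod int N = int b mod int N" for a b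
    using that by (simp add: cong_int_iff[symmetric] cong_def)
  have w: "w = replicate l 2 @ replicate (residue (- int l)) 3 @ replicate k 1 @ replicate (residue (- int k)) 2
      @ replicate (residue i) 2 @ replicate (residue (- i)) 3"
    by (simp add: w_def g_word_def numeral_2_eq_2 numeral_3_eq_3)
  have "[int l + (int (residue (- int k)) + int (residue i)) = - i + (int (residue (- int k)) + i)] (mod int N)"
    unfolding l_def by (intro cong_add residue_cong_self cong_refl)
  then have "[int (l + (residue (- int k) + residue i)) = int (residue (- int k))] (mod int N)"
    by simp
  then have two: "[l + (residue (- int k) + residue i) = residue (- int k)] (mod N)"
    by (simp only: cong_int_iff)
  show "w \<approx>\<^sub>N g_word (int k)"
    unfolding word_cong_def
  proof
    fix j
    show "[count_list w j = count_list (g_word (int k)) j] (mod N)"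
      unfolding w g_word_def using two
      by (cases "j = 2") (simp, auto intro!: cong simp: l_def int_residue mod_simps)
  qed
  have "inversions w = l * k + residue (- int l) * k + residue (- int l) * residue (- int k) + residue (- int l) * residue i"
    unfolding w by simp
  then have inv: "int (inversions w) = int l * int k + int (residue (- int l)) * int k
      + int (residue (- int l)) * int (residue (- int k)) + int (residue (- int l)) * int (residue i)"
    by simp
  have l: "[int l = - i] (mod int N)" unfolding l_def by (rule residue_cong_self)
  have "[- int l = - (- i)] (mod int N)" using l by (simp only: cong_minus_minus_iff)
  from cong_trans[OF residue_cong_self this] have l': "[int (residue (- int l)) = i] (mod int N)"
    by (simp only: minus_minus)
  have "[int (inversions w) = - i * int k + i * int k + i * - int k + i * i] (mod int N)"
    unfolding inv by (intro cong_add cong_mult l l' residue_cong_self cong_refl)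
  then have "[int (inversions w) = i\<^sup>2 - i * int k] (mod int N)"
    by (simp add: power2_eq_square)
  then have "q powi int (inversions w) = q powi (i\<^sup>2 - i * int k)"
    by (rule q_powi_cong)
  then show "phase w = q powi (i\<^sup>2 - i * int k)" by (simp add: phase_def)
qed

end

context parafermions_root
begin

abbreviation E_sum :: "nat \<Rightarrow> free_elem"
  where "E_sum i \<equiv> \<Sum>k<N. wterm (E_word i k) (\<zeta> ^ (k\<^sup>2))"

abbreviation root_N :: complex
  where "root_N \<equiv> of_real (sqrt (real N))"

lemma root_N_nonzero [simp]: "root_N \<noteq> 0"
  using N_pos by simp

definition E_rep :: "nat \<Rightarrow> free_elem"
  where "E_rep i = free_const (1 / root_N) * E_sum i"

lemma set_E_word: "1 \<le> i \<Longrightarrow> i < n \<Longrightarrow> set (E_word i k) \<subseteq> {1..n}"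
  by (auto split: if_splits)

lemma E_rep_closed: "1 \<le> i \<Longrightarrow> i < n \<Longrightarrow> E_rep i \<in> carrier (free_alg n)"
  unfolding E_rep_def
  by (intro free_alg_closed_mult free_const_closed free_alg_closed_sum wterm_closed set_E_word)

lemma pf_E_eq:
  assumes "1 \<le> i" "i < n"
  shows "pf_E N \<zeta> n i = pf_class N n (E_rep i)"
proof -
  have sets: "set (replicate k i) \<subseteq> {1..n}" "set (replicate k (Suc i)) \<subseteq> {1..n}" for k
    using assms by (auto split: if_splits)
  have "(pf_gen N n i [^]\<^bsub>PF N n\<^esub> k) \<otimes>\<^bsub>PF N n\<^esub> (pf_gen N n (i + 1) [^]\<^bsub>PF N n\<^esub> (- int k)) =
      pf_class N n (wterm (E_word i k) 1)" for k :: nat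
  proof -
    have i: "i \<in> {1..n}" "i + 1 \<in> {1..n}" using assms by auto
    show ?thesis
      unfolding pf_gen_nat_pow[OF i(1)] pf_gen_int_pow[OF i(2)]
      using pf_class_wterm_mult[OF sets] by simp
  qed
  then have "pf_E N \<zeta> n i = pf_smult N n (1 / root_N)
      (\<Oplus>\<^bsub>PF N n\<^esub>k\<in>{..<N}. pf_class N n (wterm (E_word i k) (\<zeta> ^ (k\<^sup>2))))"
    unfolding pf_E_def by (simp only: pf_smult_wterm[OF set_E_word[OF assms]] mult_1_right)
  also have "(\<Oplus>\<^bsub>PF N n\<^esub>k\<in>{..<N}. pf_class N n (wterm (E_word i k) (\<zeta> ^ (k\<^sup>2)))) = pf_class N n (E_sum i)"
    using pf_class_finsum[of "{..<N}" "\<lambda>k. wterm (E_word i k) (\<zeta> ^ (k\<^sup>2))" n N] wterm_closed[OF set_E_word[OF assms]]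
    by simp
  finally show ?thesis
    unfolding E_rep_def
    by (subst (asm) pf_smult_class) (intro free_alg_closed_sum wterm_closed set_E_word[OF assms])
qed

text \<open>The transform computed in the free algebra, where sums and products are ordinary ring
  operations.\<close>

definition SFT_rep :: "free_elem \<Rightarrow> free_elem"
  where "SFT_rep p = free_const root_N * normal_form 2 (E_rep 2 * (E_rep 1 * shift p))"

lemma pf_SFT_class:
  assumes "p \<in> carrier (free_alg 2)"
  shows "pf_SFT N \<zeta> 2 (pf_class N 2 p) = pf_class N 2 (SFT_rep p)"
proof -
  have upt: "rev [1..<Suc 2] = [2, 1]" by (simp add: upt_rec)
  have E: "E_rep 2 \<in> carrier (free_alg (Suc 2))" "E_rep 1 \<in> carrier (free_alg (Suc 2))"
    by (simp_all add: E_rep_closed)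
  have s: "shift p \<in> carrier (free_alg (Suc 2))" using shift_closed[OF assms] .
  have "pf_E N \<zeta> (Suc 2) 2 \<otimes>\<^bsub>PF N (Suc 2)\<^esub> (pf_E N \<zeta> (Suc 2) 1 \<otimes>\<^bsub>PF N (Suc 2)\<^esub> pf_iota_l N 2 (pf_class N 2 p)) =
      pf_class N (Suc 2) (E_rep 2 * (E_rep 1 * shift p))"
    using E s by (simp add: pf_E_eq pf_iota_l_class[OF assms] pf_class_mult free_alg_closed_mult)
  then show ?thesis
    unfolding pf_SFT_def upt SFT_rep_def Suc_eq_plus1[symmetric]
    using pf_Phi_r_class[of "E_rep 2 * (E_rep 1 * shift p)" 2] E s
    by (simp add: pf_smult_class normal_form_closed free_alg_closed_mult)
qed

lemma SFT_rep_add: "SFT_rep (p + r) = SFT_rep p + SFT_rep r"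
  by (simp add: SFT_rep_def shift_add distrib_left normal_form_add)

lemma SFT_rep_zero: "SFT_rep 0 = 0"
  using SFT_rep_add[of 0 0] by simp

lemma SFT_rep_sum: "SFT_rep (sum f A) = (\<Sum>x\<in>A. SFT_rep (f x))"
  by (induct A rule: infinite_finite_induct) (simp_all add: SFT_rep_zero SFT_rep_add)

lemma SFT_rep_wterm: "SFT_rep (wterm u (a * b)) = free_const a * SFT_rep (wterm u b)"
proof -
  have "shift (wterm u (a * b)) = free_const a * shift (wterm u b)"
    by (simp add: shift_wterm free_const_mult_wterm)
  then show ?thesis
    by (simp only: SFT_rep_def normal_form_const_mult
        free_const_left_commute[of "E_rep _"] free_const_left_commute[of "free_const root_N" a])
qed

lemma normal_form_sum: "normal_form m (sum f A) = (\<Sum>x\<in>A. normal_form m (f x))"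
proof -
  have "normal_form m 0 = 0" using normal_form_add[of m 0 0] by simp
  then show ?thesis
    by (induct A rule: infinite_finite_induct) (simp_all add: normal_form_add)
qed

lemma SFT_rep_eq_sum:
  "SFT_rep p = free_const (1 / root_N) * (\<Sum>l<N. \<Sum>k<N.
    normal_form 2 (wterm (E_word 2 l) (\<zeta> ^ (l\<^sup>2)) * (wterm (E_word 1 k) (\<zeta> ^ (k\<^sup>2)) * shift p)))"
proof -
  have "E_rep 2 * (E_rep 1 * shift p) =
      free_const (1 / root_N * (1 / root_N)) * (E_sum 2 * (E_sum 1 * shift p))"
    unfolding E_rep_def by (simp only: mult.assoc free_const_left_commute[of "E_sum _"] free_const_mult)
  also have "E_sum 2 * (E_sum 1 * shift p) =
      (\<Sum>l<N. \<Sum>k<N. wterm (E_word 2 l) (\<zeta> ^ (l\<^sup>2)) * (wterm (E_word 1 k) (\<zeta> ^ (k\<^sup>2)) * shift p))"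
    by (simp only: sum_distrib_left sum_distrib_right) (rule sum.swap)
  finally show ?thesis
    unfolding SFT_rep_def
    by (simp only: normal_form_const_mult normal_form_sum free_const_mult) simp
qed

text \<open>Only \<open>l = - i\<close> contributes to the double sum. There the phases combine to
  \<open>\<zeta>\<^bsup>2 i\<^sup>2\<^esup> \<zeta>\<^bsup>k\<^sup>2\<^esup> q\<^bsup>i k - i\<^sup>2\<^esup> = q\<^bsup>i k\<^esup> \<zeta>\<^bsup>k\<^sup>2\<^esup>\<close>, which turns the remaining sum over \<open>k\<close> into the
  Fourier sum.\<close>

theorem SFT_rep_g:
  "pf_class N 2 (SFT_rep (g_term i)) =
    pf_class N 2 (free_const (1 / root_N) * (\<Sum>j<N. free_const (q powi (i * int j)) * g_term (int j)))"
proof -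
  define l\<^sub>0 where "l\<^sub>0 = residue (- i)"
  let ?w = "\<lambda>l k. E_word 2 l @ E_word 1 k @ map Suc (g_word i)"
  let ?a = "\<lambda>l k. \<zeta> ^ (l\<^sup>2) * (\<zeta> ^ (k\<^sup>2) * \<zeta> powi (i\<^sup>2))"
  \<comment> \<open>The exponent of \<open>c\<^sub>3\<close> is \<open>- l - i\<close>, which is nonzero modulo \<open>N\<close> unless \<open>l = l\<^sub>0\<close>.\<close>
  have other: "normal_form 2 (wterm (?w l k) (?a l k)) = 0" if "l < N" "l \<noteq> l\<^sub>0" for l k
  proof -
    have count: "count_list (?w l k) (Suc 2) = residue (- int l) + residue (- i)"
      by (simp add: g_word_def)
    have "\<not> N dvd residue (- int l) + residue (- i)"
    proof
      assume "N dvd residue (- int l) + residue (- i)"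
      then have "int N dvd int (residue (- int l)) + int (residue (- i))"
        by (simp only: int_dvd_int_iff flip: of_nat_add)
      then have "int N dvd - int l + - i"
        by (simp only: cong_dvd_iff[OF cong_add[OF residue_cong_self residue_cong_self]])
      then have "int N dvd - (int l - - i)" by simp
      then have "[int l = - i] (mod int N)" by (simp only: dvd_minus_iff cong_iff_dvd_diff)
      then have "residue (int l) = l\<^sub>0" unfolding l\<^sub>0_def by (rule residue_cong)
      then show False using that by (simp add: residue_of_nat)
    qed
    then show ?thesis
      using count by (intro normal_form_wterm_eq_0) simp
  qed
  have main: "pf_class N 2 (normal_form 2 (wterm (?w l\<^sub>0 k) (?a l\<^sub>0 k))) =
      pf_class N 2 (free_const (q powi (i * int k)) * g_term (int k))" for k
  proof -
    have set_w: "set (?w l\<^sub>0 k) \<subseteq> {1..Suc 2}" "set (g_word (int k)) \<subseteq> {1..Suc 2}"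
      by (auto simp: g_word_def split: if_splits)
    have w: "?w l\<^sub>0 k \<approx>\<^sub>N g_word (int k)" "phase (?w l\<^sub>0 k) = q powi (i\<^sup>2 - i * int k)"
      unfolding l\<^sub>0_def by (rule E2_E1_word)+
    \<comment> \<open>The representative \<open>l\<^sub>0\<close> of \<open>- i\<close> contributes the same Gaussian factor as \<open>i\<close> itself.\<close>
    have "\<zeta> ^ (l\<^sub>0\<^sup>2) = \<zeta> powi ((int l\<^sub>0)\<^sup>2)"
      by (simp flip: of_nat_power)
    also have "\<dots> = \<zeta> powi ((- i)\<^sup>2)"
      by (rule \<zeta>_powi_square_cong) (simp add: l\<^sub>0_def int_residue cong_def)
    finally have "\<zeta> ^ (l\<^sub>0\<^sup>2) * \<zeta> powi (i\<^sup>2) = \<zeta> powi (2 * i\<^sup>2)"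
      by (simp only: power2_minus mult_2 power_int_add[OF disjI1[OF \<zeta>_nonzero]])
    then have l\<^sub>0: "\<zeta> ^ (l\<^sub>0\<^sup>2) * \<zeta> powi (i\<^sup>2) = q powi (i\<^sup>2)"
      by (simp only: \<zeta>_powi_double)
    have "?a l\<^sub>0 k * (phase (g_word (int k)) / phase (?w l\<^sub>0 k)) =
        \<zeta> ^ (k\<^sup>2) * (q powi (i\<^sup>2) / q powi (i\<^sup>2 - i * int k))"
      unfolding w(2) l\<^sub>0[symmetric] by simp
    also have "\<dots> = \<zeta> ^ (k\<^sup>2) * q powi (i * int k)"
      by (simp add: power_int_diff)
    also have "\<dots> = q powi (i * int k) * \<zeta> powi ((int k)\<^sup>2)"
      by (simp add: mult.commute flip: of_nat_power)
    finally have coeff: "?a l\<^sub>0 k * (phase (g_word (int k)) / phase (?w l\<^sub>0 k)) =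
        q powi (i * int k) * \<zeta> powi ((int k)\<^sup>2)" .
    have "pf_class N (Suc 2) (wterm (?w l\<^sub>0 k) (?a l\<^sub>0 k)) =
        pf_class N (Suc 2) (wterm (g_word (int k)) (q powi (i * int k) * \<zeta> powi ((int k)\<^sup>2)))"
      using pf_class_wterm_cong[OF w(1) set_w, of "?a l\<^sub>0 k"] unfolding coeff .
    then have "normal_form 2 (wterm (?w l\<^sub>0 k) (?a l\<^sub>0 k)) =
        normal_form 2 (wterm (g_word (int k)) (q powi (i * int k) * \<zeta> powi ((int k)\<^sup>2)))"
      by (rule normal_form_eq_if_pf_class_eq[OF wterm_closed[OF set_w(1)] wterm_closed[OF set_w(2)]])
    then show ?thesis
      by (simp only: pf_class_normal_form[OF wterm_closed[OF set_g_word]] free_const_mult_wterm)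
  qed
  have "(\<Sum>l<N. \<Sum>k<N. normal_form 2 (wterm (E_word 2 l) (\<zeta> ^ (l\<^sup>2)) * (wterm (E_word 1 k) (\<zeta> ^ (k\<^sup>2)) * shift (g_term i))))
      = (\<Sum>l<N. \<Sum>k<N. normal_form 2 (wterm (?w l k) (?a l k)))"
    by (simp only: shift_wterm wterm_mult append_assoc)
  also have "\<dots> = (\<Sum>l<N. if l = l\<^sub>0 then (\<Sum>k<N. normal_form 2 (wterm (?w l\<^sub>0 k) (?a l\<^sub>0 k))) else 0)"
  proof (rule sum.cong[OF refl])
    fix l assume "l \<in> {..<N}"
    then show "(\<Sum>k<N. normal_form 2 (wterm (?w l k) (?a l k))) =
        (if l = l\<^sub>0 then (\<Sum>k<N. normal_form 2 (wterm (?w l\<^sub>0 k) (?a l\<^sub>0 k))) else 0)"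
      using other[of l] by (simp only: lessThan_iff if_split) (auto intro: sum.neutral)
  qed
  also have "\<dots> = (\<Sum>k<N. normal_form 2 (wterm (?w l\<^sub>0 k) (?a l\<^sub>0 k)))"
    using residue_less[of "- i"] unfolding l\<^sub>0_def by (subst sum.delta) simp_all
  finally have SFT: "SFT_rep (g_term i) = free_const (1 / root_N) * (\<Sum>k<N. normal_form 2 (wterm (?w l\<^sub>0 k) (?a l\<^sub>0 k)))"
    unfolding SFT_rep_eq_sum by (rule arg_cong)
  have closed: "free_const (q powi (i * int k)) * g_term (int k) \<in> carrier (free_alg 2)" for k
    by (intro free_alg_closed_mult free_const_closed g_term_closed)
  have "pf_class N 2 (\<Sum>k<N. normal_form 2 (wterm (?w l\<^sub>0 k) (?a l\<^sub>0 k))) =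
      pf_class N 2 (\<Sum>k<N. free_const (q powi (i * int k)) * g_term (int k))"
    by (rule pf_class_sum_cong[OF normal_form_closed closed main])
  then show ?thesis
    unfolding SFT
    by (simp only: pf_smult_class[symmetric] free_alg_closed_sum normal_form_closed closed)
qed

lemma pf_SFT_g:
  "pf_SFT N \<zeta> 2 (pf_g N \<zeta> i) =
    pf_smult N 2 (1 / root_N)
      (\<Oplus>\<^bsub>PF N 2\<^esub>j\<in>{..<N}. pf_smult N 2 (q powi (i * int j)) (pf_g N \<zeta> (int j)))"
proof -
  have closed: "free_const (q powi (i * int j)) * g_term (int j) \<in> carrier (free_alg 2)" for j
    by (intro free_alg_closed_mult free_const_closed g_term_closed)
  show ?thesis
    unfolding pf_g_eq pf_SFT_class[OF g_term_closed] SFT_rep_g pf_smult_class[OF g_term_closed]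
    by (subst pf_class_finsum[OF finite_lessThan closed])
      (rule pf_smult_class[symmetric], rule free_alg_closed_sum, rule closed)
qed

lemma pf_SFT_dft:
  "pf_SFT N \<zeta> 2 (\<Oplus>\<^bsub>PF N 2\<^esub>i\<in>{..<N}. pf_smult N 2 (a i) (pf_g N \<zeta> (int i))) =
    (\<Oplus>\<^bsub>PF N 2\<^esub>j\<in>{..<N}. pf_smult N 2 (dft N a j) (pf_g N \<zeta> (int j)))"
proof -
  have closed: "free_const c * g_term j \<in> carrier (free_alg 2)" for c j
    by (intro free_alg_closed_mult free_const_closed g_term_closed)
  have comb: "(\<Oplus>\<^bsub>PF N 2\<^esub>i\<in>{..<N}. pf_smult N 2 (b i) (pf_g N \<zeta> (int i))) =
      pf_class N 2 (\<Sum>i<N. free_const (b i) * g_term (int i))" for b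
    unfolding pf_g_eq pf_smult_class[OF g_term_closed] by (rule pf_class_finsum[OF finite_lessThan closed])
  have SFT_closed: "SFT_rep p \<in> carrier (free_alg 2)" for p
    unfolding SFT_rep_def by (intro free_alg_closed_mult free_const_closed normal_form_closed)
  let ?S = "\<lambda>i. free_const (1 / root_N) * (\<Sum>j<N. free_const (q powi (int i * int j)) * g_term (int j))"
  have S_closed: "?S i \<in> carrier (free_alg 2)" for i
    by (intro free_alg_closed_mult free_alg_closed_sum free_const_closed g_term_closed)
  have "SFT_rep (\<Sum>i<N. free_const (a i) * g_term (int i)) = (\<Sum>i<N. free_const (a i) * SFT_rep (g_term (int i)))"
    by (simp only: SFT_rep_sum free_const_mult_wterm SFT_rep_wterm)
  then have "pf_class N 2 (SFT_rep (\<Sum>i<N. free_const (a i) * g_term (int i))) =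
      pf_class N 2 (\<Sum>i<N. free_const (a i) * SFT_rep (g_term (int i)))"
    by (simp only:)
  also have "\<dots> = pf_class N 2 (\<Sum>i<N. free_const (a i) * ?S i)"
  proof (rule pf_class_sum_cong)
    fix i
    show "pf_class N 2 (free_const (a i) * SFT_rep (g_term (int i))) = pf_class N 2 (free_const (a i) * ?S i)"
      unfolding pf_smult_class[OF SFT_closed, symmetric] SFT_rep_g pf_smult_class[OF S_closed] ..
  qed (intro free_alg_closed_mult free_const_closed SFT_closed S_closed)+
  also have "(\<Sum>i<N. free_const (a i) * ?S i) = (\<Sum>j<N. free_const (dft N a j) * g_term (int j))"
  proof -
    have "(\<Sum>i<N. free_const (a i) * ?S i) =
        (\<Sum>i<N. \<Sum>j<N. free_const (a i * (1 / root_N * q powi (int i * int j))) * g_term (int j))"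
      by (simp only: sum_distrib_left free_const_mult)
    also have "\<dots> = (\<Sum>j<N. \<Sum>i<N. free_const (a i * (1 / root_N * q powi (int i * int j))) * g_term (int j))"
      by (rule sum.swap)
    also have "\<dots> = (\<Sum>j<N. free_const (dft N a j) * g_term (int j))"
    proof (rule sum.cong[OF refl])
      fix j
      have const_sum: "(\<Sum>i\<in>A. free_const (c i)) = free_const (sum c A)" for c and A :: "nat set"
        by (induct A rule: infinite_finite_induct) (simp_all add: free_const_eq single_add)
      have "(\<Sum>i<N. a i * (1 / root_N * q powi (int i * int j))) = dft N a j"
        by (simp add: dft_def sum_distrib_left mult_ac flip: of_nat_mult)
      then show "(\<Sum>i<N. free_const (a i * (1 / root_N * q powi (int i * int j))) * g_term (int j)) =
          free_const (dft N a j) * g_term (int j)"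
        by (simp only: sum_distrib_right[symmetric] const_sum)
    qed
    finally show ?thesis .
  qed
  finally show ?thesis
    unfolding comb by (subst pf_SFT_class) (rule free_alg_closed_sum, rule closed)
qed

end

theorem proposition6p2:
  fixes N :: nat and \<zeta> :: complex
  assumes "N \<ge> 2"
    and "\<zeta>\<^sup>2 = pf_q N"
    and "\<zeta> ^ (N\<^sup>2) = 1"
  shows "(\<forall>i j :: int. [i = j] (mod int N) \<longrightarrow> pf_g N \<zeta> i = pf_g N \<zeta> j)
    \<and> pf_basis N 2 (map (\<lambda>i. pf_g N \<zeta> (int i)) [0..<N]) (pf_graded N 2 0)
    \<and> (\<forall>i :: int. pf_SFT N \<zeta> 2 (pf_g N \<zeta> i) =
         pf_smult N 2 (1 / of_real (sqrt (real N)))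
           (\<Oplus>\<^bsub>PF N 2\<^esub>j\<in>{..<N}. pf_smult N 2 (pf_q N powi (i * int j)) (pf_g N \<zeta> (int j))))
    \<and> (\<forall>a :: nat \<Rightarrow> complex.
         pf_SFT N \<zeta> 2 (\<Oplus>\<^bsub>PF N 2\<^esub>i\<in>{..<N}. pf_smult N 2 (a i) (pf_g N \<zeta> (int i))) =
         (\<Oplus>\<^bsub>PF N 2\<^esub>j\<in>{..<N}. pf_smult N 2 (dft N a j) (pf_g N \<zeta> (int j))))"
proof -
  interpret parafermions_root N \<zeta>
    using assms by unfold_locales simp_all
  show ?thesis
    unfolding pf_basis_def
    by (intro conjI allI impI)
      (erule pf_g_cong, rule independent_g, rule Span_g, rule pf_SFT_g, rule pf_SFT_dft)
qed

end
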